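(* Let $m,n$ be positive integers with $n\ge m-1$. Then the Ehrhart polynomial of the partial permutohedron $\mathcal{P}(m,n)$ is magic positive, except when $(m,n)=(2,1)$. In the exceptional case $(m,n)=(2,1)$, the Ehrhart polynomial of $\mathcal{P}(2,1)$ is not magic positive.
   Context: For positive integers $m,n$, the partial permutohedron $\mathcal{P}(m,n)\subset\mathbb{R}^m$ is the convex hull of all vectors in $\{0,1,\ldots,n\}^m$ whose nonzero entries are pairwise distinct. It is an $m$-dimensional lattice polytope. For a lattice polytope $\mathcal{P}\subset\mathbb{R}^N$ of dimension $d$, the Ehrhart polynomial $i(\mathcal{P},t)$ is the polynomial in $t$ (of degree $d$, with constant term $1$) satisfying $i(\mathcal{P},t)=|t\mathcal{P}\cap\mathbb{Z}^N|$ for all positive integers $t$. The Ehrhart polynomial of a $d$-dimensional lattice polytope $\mathcal{P}$ (or $\mathcal{P}$ itself) is called magic positive if $i(\mathcal{P},t)=\sum_{i=0}^d a_i\,t^i(t+1)^{d-i}$ with $a_i\ge 0$ for all $0\le i\le d$. (The polynomials $t^i(t+1)^{d-i}$, $0\le i\le d$, form a basis of the polynomials of degree at most $d$, so the $a_i$ are uniquely determined.) *)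

theory Defs
  imports "HOL-Analysis.Analysis" "HOL-Computational_Algebra.Polynomial"
begin

text \<open>The ambient space \<open>\<real>\<^sup>m\<close> is \<^typ>\<open>real ^ 'm\<close> with \<open>m = CARD('m)\<close>.\<close>

definition partial_permutohedron :: "nat \<Rightarrow> (real ^ 'm) set" where
  "partial_permutohedron n = convex hull
     {x. (\<forall>i. x $ i \<in> real ` {0..n}) \<and>
         (\<forall>i j. i \<noteq> j \<and> x $ i \<noteq> 0 \<and> x $ j \<noteq> 0 \<longrightarrow> x $ i \<noteq> x $ j)}"

definition integer_lattice :: "(real ^ 'm) set" where
  "integer_lattice = {x. \<forall>i. x $ i \<in> \<int>}"

definition is_ehrhart_poly :: "(real ^ 'm) set \<Rightarrow> real poly \<Rightarrow> bool" where
  "is_ehrhart_poly P p \<longleftrightarrow>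
     (\<forall>t::nat. t > 0 \<longrightarrow>
        poly p (real t) = real (card ((\<lambda>x. real t *\<^sub>R x) ` P \<inter> integer_lattice)))"

text \<open>A polynomial is determined by its values at the positive integers, so the description
  below picks out the Ehrhart polynomial whenever it exists, in particular for every lattice
  polytope; see \<open>ehrhart_poly_eqI\<close>.\<close>

definition ehrhart_poly :: "(real ^ 'm) set \<Rightarrow> real poly" where
  "ehrhart_poly P = (THE p. is_ehrhart_poly P p)"

lemma is_ehrhart_poly_unique:
  assumes "is_ehrhart_poly P p" and "is_ehrhart_poly P q"
  shows "p = q"
proof (rule ccontr)
  assume "p \<noteq> q"
  then have "finite {x. poly (p - q) x = 0}"
    by (intro poly_roots_finite) simp
  moreover have "real ` {0<..} \<subseteq> {x. poly (p - q) x = 0}"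
    using assms by (auto simp: is_ehrhart_poly_def)
  ultimately have "finite (real ` {0<..})"
    by (rule finite_subset[rotated])
  then have "finite {0::nat<..}"
    by (rule finite_imageD) (simp add: inj_on_def)
  then show False
    by (simp add: infinite_Ioi)
qed

lemma ehrhart_poly_eqI: "is_ehrhart_poly P p \<Longrightarrow> ehrhart_poly P = p"
  unfolding ehrhart_poly_def by (blast intro: is_ehrhart_poly_unique)

definition magic_positive_poly :: "nat \<Rightarrow> real poly \<Rightarrow> bool" where
  "magic_positive_poly d p \<longleftrightarrow>
     (\<exists>a :: nat \<Rightarrow> real. (\<forall>i\<le>d. a i \<ge> 0) \<and>
        p = (\<Sum>i\<le>d. smult (a i) ([:0, 1:] ^ i * [:1, 1:] ^ (d - i))))"

text \<open>For a lattice polytope \<open>P\<close>; \<^const>\<open>aff_dim\<close> is integer-valued because the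
  empty set has dimension \<open>-1\<close>.\<close>

definition magic_positive :: "(real ^ 'm) set \<Rightarrow> bool" where
  "magic_positive P \<longleftrightarrow> magic_positive_poly (nat (aff_dim P)) (ehrhart_poly P)"

end

theory Submission
  imports Defs "HOL-Computational_Algebra.Formal_Power_Series"
begin

text \<open>Why the theorem holds. Write \<open>P = P(m,n)\<close> with \<open>n \<ge> m - 1\<close>.

For such \<open>n\<close> the polytope is a polymatroid: it is cut out of the nonnegative orthant by the inequalities
\<open>x(S) \<le> n + (n - 1) + \<dots> + (n - |S| + 1)\<close> (\<open>mem_partial_permutohedron_iff\<close>). The substitution
\<open>y = t n - x\<close> therefore identifies the lattice points of \<open>t P\<close> with the integer vectors \<open>y\<close> whose
entries are at most \<open>N = t n\<close> and which satisfy \<open>y(S) \<ge> t (|S| choose 2)\<close> for all \<open>S\<close>. This is the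
Landau condition that describes score vectors of \<open>t\<close>-fold tournaments, except that the total score may be
too large; a set for which it is an equality is called tight.

Let \<open>F\<^sub>m(N)\<close> be the number of these vectors. If \<open>N\<close> is large enough, entries equal to the bound satisfy
every inequality by themselves, so passing from \<open>N\<close> to \<open>N + 1\<close> multiplies the exponential generating
function by \<open>exp z\<close>, and \<open>\<Sum> F\<^sub>m(N) z\<^sup>m / m! = exp(N z) c(z)\<close> with a series \<open>c\<close> that depends on \<open>t\<close> only
(\<open>num_scores_Suc\<close>, \<open>appell_sequence_egf\<close>). The series is found by splitting each \<open>y\<close> along its largest
tight set \<open>T(y)\<close>: on \<open>T(y)\<close> it is a lattice point of a dilated permutohedron, and outside, after a shift, it
satisfies strict inequalities (\<open>card_max_tight_fibre\<close>). On the other hand a coordinate belongs to \<open>T(y)\<close>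
exactly when it is as small as the other coordinates allow, so the sums of \<open>|T(y)|\<close> and of \<open>y(T(y))\<close> over
all \<open>y\<close> can be expressed by \<open>F\<close> alone, while \<open>y(T(y)) = t (|T(y)| choose 2)\<close> because \<open>T(y)\<close> is tight
(\<open>max_tight_moments\<close>). These relations form a system of differential equations whose solution is
\<open>c = (1 - t z)\<^bsup>1/2\<^esup> exp((1 + t/2) z - t z\<^sup>2 / 4)\<close>; it also gives the count \<open>G\<^sub>m(N)\<close> for the strict
inequalities (\<open>num_scores_exponential_formula\<close>).

Rescaling \<open>z\<close> by \<open>t\<close> expands \<open>F\<^sub>m(t n)\<close> in the magic basis (\<open>magic_expansion\<close>). The series in that
expansion depend on \<open>n\<close>, hence on \<open>m\<close>; Lagrange inversion turns the coefficient of
\<open>t\<^bsup>m-j\<^esup> (t+1)\<^sup>j\<close> into \<open>m!/j!\<close> times the coefficient of \<open>z\<^sup>m\<close> in \<open>\<alpha>\<^sup>j b\<close>, where \<open>b\<close> depends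
only on the difference \<open>n - m\<close>. Here \<open>\<alpha>\<close> has the nonnegative coefficients \<open>k\<^bsup>k-2\<^esup> (k + 1) / (2 k!)\<close>,
and \<open>r!\<close> times the coefficient of \<open>z\<^sup>r\<close> in \<open>b\<close> is the number of interior lattice points of
\<open>P(r, r + n - m)\<close>, as soon as \<open>r > 0\<close> and \<open>r + n - m > 0\<close>. The only negative coefficient that \<open>b\<close> can have is therefore
the one of \<open>z\<close> for \<open>n = m - 1\<close>, where \<open>b = 1 - z + \<dots>\<close>. Since the coefficients of \<open>\<alpha>\<close> increase from the second
one on, \<open>\<alpha>\<^sup>j (1 - z)\<close> is nonnegative for \<open>j \<ge> 2\<close>, and \<open>\<alpha> (1 - z)\<close> fails to be so only at \<open>z\<^sup>2\<close>
(\<open>sign_of_magic_coefficients\<close>). This single failure is the case \<open>(m,n) = (2,1)\<close>;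
for \<open>j = 0\<close> the negative coefficient of \<open>b\<close> itself would require \<open>m = 1\<close> and \<open>n = 0\<close>.\<close>

section \<open>Score vectors\<close>

lemma choose_two_add: "(a + b choose 2) = (a choose 2) + (b choose 2) + a * b"
  by (induction b) (simp_all add: numeral_2_eq_2)

lemma choose_two_double: "2 * (a choose 2) = a * (a - 1)"
  by (induction a) (simp_all add: numeral_2_eq_2 algebra_simps)

text \<open>For \<open>e = 0\<close> these are the lattice points of the dilated polytope after the substitution, and for
\<open>e = 1\<close> all lower inequalities are strict. Both counts satisfy the same recursion in the bound \<open>N\<close>.
Vectors are extensional functions on an arbitrary finite index set, because coordinates are added and removed.\<close>

definition score_vectors :: "nat \<Rightarrow> nat \<Rightarrow> nat \<Rightarrow> 'a set \<Rightarrow> ('a \<Rightarrow> nat) set" where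
  "score_vectors t e N A = {y \<in> A \<rightarrow>\<^sub>E {..N}.
     \<forall>S\<subseteq>A. S \<noteq> {} \<longrightarrow> t * (card S choose 2) + e \<le> sum y S}"

lemma finite_score_vectors: "finite A \<Longrightarrow> finite (score_vectors t e N A)"
  unfolding score_vectors_def by (rule finite_subset[of _ "A \<rightarrow>\<^sub>E {..N}"]) (auto intro: finite_PiE)

lemma score_vectors_sum_ge:
  "y \<in> score_vectors t e N A \<Longrightarrow> S \<subseteq> A \<Longrightarrow> S \<noteq> {} \<Longrightarrow> t * (card S choose 2) + e \<le> sum y S"
  by (simp add: score_vectors_def)

lemma score_vectors_sum_ge_0:
  "y \<in> score_vectors t e N A \<Longrightarrow> S \<subseteq> A \<Longrightarrow> t * (card S choose 2) \<le> sum y S"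
  using score_vectors_sum_ge[of y t e N A S] by (cases "S = {}") (auto simp: numeral_2_eq_2)

lemma score_vectors_PiE: "y \<in> score_vectors t e N A \<Longrightarrow> y \<in> A \<rightarrow>\<^sub>E {..N}"
  by (simp add: score_vectors_def)

lemma score_vectors_le: "y \<in> score_vectors t e N A \<Longrightarrow> i \<in> A \<Longrightarrow> y i \<le> N"
  using score_vectors_PiE by fastforce

lemma score_vectors_undefined: "y \<in> score_vectors t e N A \<Longrightarrow> i \<notin> A \<Longrightarrow> y i = undefined"
  using score_vectors_PiE PiE_arb by metis

lemma score_vectorsI:
  assumes "y \<in> A \<rightarrow>\<^sub>E {..N}"
    and "\<And>S. S \<subseteq> A \<Longrightarrow> S \<noteq> {} \<Longrightarrow> t * (card S choose 2) + e \<le> sum y S"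
  shows "y \<in> score_vectors t e N A"
  using assms by (simp add: score_vectors_def)

text \<open>Counts depend on the index set through its cardinality only. The extra predicate on the total makes the
statement cover the vectors for which the whole index set is tight as well.\<close>

lemma card_score_vectors_bij_le:
  assumes f: "bij_betw f A B" and A: "finite A"
  shows "card {y \<in> score_vectors t e N B. P (sum y B)} \<le> card {y \<in> score_vectors t e N A. P (sum y A)}"
proof (rule card_inj_on_le)
  let ?f = "\<lambda>y. restrict (y \<circ> f) A"
  have sum: "sum (?f y) S = sum y (f ` S)" if "S \<subseteq> A" for y :: "'b \<Rightarrow> nat" and S
  proof -
    have "inj_on f S" using f that by (meson bij_betw_def inj_on_subset)
    moreover have "sum (?f y) S = sum (y \<circ> f) S" using that by (intro sum.cong) auto
    ultimately show ?thesis by (simp add: sum.reindex)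
  qed
  have fA: "f ` A = B" using f by (simp add: bij_betw_def)
  show "?f ` {y \<in> score_vectors t e N B. P (sum y B)} \<subseteq> {y \<in> score_vectors t e N A. P (sum y A)}"
  proof clarify
    fix y assume y: "y \<in> score_vectors t e N B" and P: "P (sum y B)"
    have "?f y \<in> score_vectors t e N A"
    proof (rule score_vectorsI)
      show "?f y \<in> A \<rightarrow>\<^sub>E {..N}" using score_vectors_le[OF y] fA by auto
      fix S assume S: "S \<subseteq> A" "S \<noteq> {}"
      then have "card (f ` S) = card S"
        using f by (meson bij_betw_def card_image inj_on_subset)
      moreover have "f ` S \<subseteq> B" "f ` S \<noteq> {}" using S fA by auto
      ultimately show "t * (card S choose 2) + e \<le> sum (?f y) S"
        using score_vectors_sum_ge[OF y, of "f ` S"] by (simp add: sum[OF S(1)] del: restrict_apply image_is_empty)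
    qed
    moreover have "P (sum (?f y) A)" using P by (simp only: sum[OF subset_refl] fA)
    ultimately show "?f y \<in> score_vectors t e N A \<and> P (sum (?f y) A)" by blast
  qed
  show "inj_on ?f {y \<in> score_vectors t e N B. P (sum y B)}"
  proof (rule inj_onI, clarify)
    fix y y' assume y: "y \<in> score_vectors t e N B" "y' \<in> score_vectors t e N B" and eq: "?f y = ?f y'"
    have "y b = y' b" if "b \<in> B" for b
    proof -
      obtain a where "a \<in> A" "b = f a" using \<open>b \<in> B\<close> fA by blast
      then show ?thesis using fun_cong[OF eq, of a] by simp
    qed
    then show "y = y'" by (rule PiE_ext[OF score_vectors_PiE[OF y(1)] score_vectors_PiE[OF y(2)]])
  qed
  show "finite {y \<in> score_vectors t e N A. P (sum y A)}"
    using A by (simp add: finite_score_vectors)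
qed

lemma card_score_vectors_bij:
  assumes f: "bij_betw f A B" and A: "finite A"
  shows "card {y \<in> score_vectors t e N B. P (sum y B)} = card {y \<in> score_vectors t e N A. P (sum y A)}"
  using assms card_score_vectors_bij_le[OF f A] card_score_vectors_bij_le[OF bij_betw_inv_into[OF f]]
    bij_betw_finite[OF f] by (meson le_antisym)

definition num_scores :: "nat \<Rightarrow> nat \<Rightarrow> nat \<Rightarrow> nat \<Rightarrow> nat" where
  "num_scores t e N m = card (score_vectors t e N {..<m})"

text \<open>The lattice points of the \<open>t\<close>-fold dilation of the permutohedron on \<open>0, \<dots>, m - 1\<close>. The bound \<open>t m\<close> is
implied by the other conditions; any larger one would give the same set.\<close>

definition num_tight_scores :: "nat \<Rightarrow> nat \<Rightarrow> nat" where
  "num_tight_scores t m = card {y \<in> score_vectors t 0 (t * m) {..<m}. sum y {..<m} = t * (m choose 2)}"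

lemma card_score_vectors:
  assumes "finite A"
  shows "card (score_vectors t e N A) = num_scores t e N (card A)"
proof -
  obtain h where "bij_betw h A {0..<card A}" using ex_bij_betw_finite_nat[OF assms] by blast
  then show ?thesis
    using card_score_vectors_bij[of h A "{..<card A}" t e N "\<lambda>_. True"] assms
    by (simp add: num_scores_def atLeast0LessThan)
qed

lemma card_base_vectors:
  assumes "finite A"
  shows "card {y \<in> score_vectors t 0 (t * card A) A. sum y A = t * (card A choose 2)} = num_tight_scores t (card A)"
proof -
  obtain h where "bij_betw h A {0..<card A}" using ex_bij_betw_finite_nat[OF assms] by blast
  then show ?thesis
    using card_score_vectors_bij[of h A "{..<card A}" t 0 "t * card A" "\<lambda>s. s = t * (card A choose 2)"] assms
    by (simp add: num_tight_scores_def atLeast0LessThan)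
qed

lemma num_scores_0 [simp]: "num_scores t e N 0 = 1"
  by (simp add: num_scores_def score_vectors_def)

lemma num_tight_scores_0 [simp]: "num_tight_scores t 0 = 1"
proof -
  have "{y \<in> score_vectors t 0 (t * 0) {..<0::nat}. sum y {..<0} = t * (0 choose 2)} = {\<lambda>_. undefined}"
    by (auto simp: score_vectors_def numeral_2_eq_2)
  then show ?thesis by (simp add: num_tight_scores_def)
qed

lemma sum_Pow_card:
  fixes F :: "nat \<Rightarrow> nat"
  assumes "finite A"
  shows "(\<Sum>S\<in>Pow A. F (card S)) = (\<Sum>k\<le>card A. (card A choose k) * F k)"
proof -
  have "(\<Sum>S\<in>Pow A. F (card S)) = (\<Sum>k\<le>card A. \<Sum>S\<in>{S\<in>Pow A. card S = k}. F (card S))"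
    using assms by (intro sum.group[symmetric]) (auto intro: card_mono)
  also have "\<dots> = (\<Sum>k\<le>card A. (card A choose k) * F k)"
    using n_subsets[OF assms] by (intro sum.cong) (simp_all add: Pow_def)
  finally show ?thesis .
qed

lemma sum_by_fibre:
  fixes f :: "'b \<Rightarrow> 'a set" and h :: "'a set \<Rightarrow> nat"
  assumes "finite A" "finite X" "\<And>x. x \<in> X \<Longrightarrow> f x \<subseteq> A"
  shows "(\<Sum>x\<in>X. h (f x)) = (\<Sum>S\<in>Pow A. h S * card {x \<in> X. f x = S})"
proof -
  have "(\<Sum>x\<in>X. h (f x)) = (\<Sum>S\<in>Pow A. \<Sum>x\<in>{x\<in>X. f x = S}. h (f x))"
    using assms by (intro sum.group[symmetric]) auto
  also have "\<dots> = (\<Sum>S\<in>Pow A. h S * card {x \<in> X. f x = S})"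
    by (intro sum.cong) simp_all
  finally show ?thesis .
qed

text \<open>The reason why entries with the maximal value \<open>N + 1\<close> are harmless: each of the \<open>a\<close> of them contributes at least
\<open>t (a + b - 1)\<close>, which pays for all pairs that involve it, and even pays twice for the pairs inside the
\<open>a\<close> entries. The surplus covers \<open>e\<close> when there are no other entries.\<close>

lemma full_entries_bound:
  fixes t m N e a b s :: nat
  assumes N: "t * (m - 1) \<le> N + 1" and e: "e \<le> 1" and a: "a \<ge> 1" and ab: "a + b \<le> m"
    and s: "b > 0 \<Longrightarrow> t * (b choose 2) + e \<le> s"
  shows "t * (a + b choose 2) + e \<le> a * (N + 1) + s"
proof -
  have "t * (a + b - 1) \<le> N + 1"
    using N ab by (meson diff_le_mono le_trans mult_le_mono2)
  then have "a * (t * (a + b - 1)) \<le> a * (N + 1)" by (rule mult_le_mono2)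
  moreover have "a * (t * (a + b - 1)) = t * (2 * (a choose 2) + a * b)"
    using a by (simp add: choose_two_double) (simp add: algebra_simps)
  ultimately have full: "2 * (t * (a choose 2)) + t * (a * b) \<le> a * (N + 1)"
    by (simp add: algebra_simps)
  have expand: "t * (a + b choose 2) = t * (a choose 2) + t * (b choose 2) + t * (a * b)"
    by (simp add: choose_two_add algebra_simps)
  show ?thesis
  proof (cases "b = 0")
    case True
    have "1 \<le> a * (N + 1)" using a by simp
    then have "t * (a choose 2) + e \<le> a * (N + 1)"
      using full e by (cases "t * (a choose 2) = 0") linarith+
    then show ?thesis using True by simp
  next
    case False
    then show ?thesis using s full expand by linarith
  qed
qed

text \<open>Sort the vectors by the set of coordinates where the new bound \<open>N + 1\<close> is attained. Deleting these coordinates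
is a bijection onto the vectors with the old bound, because full entries satisfy all inequalities by themselves.\<close>

lemma num_scores_Suc:
  assumes N: "t * (m - 1) \<le> N + 1" and e: "e \<le> 1"
  shows "num_scores t e (N + 1) m = (\<Sum>k\<le>m. (m choose k) * num_scores t e N (m - k))"
proof -
  define A where "A = {..<m}"
  have A: "finite A" "card A = m" by (simp_all add: A_def)
  define full where "full y = {i \<in> A. y i = N + 1}" for y :: "nat \<Rightarrow> nat"
  have fibre: "card {y \<in> score_vectors t e (N + 1) A. full y = S} = num_scores t e N (m - card S)"
    if S: "S \<subseteq> A" for S
  proof -
    let ?g = "\<lambda>z i. if i \<in> S then N + 1 else z i"
    have "bij_betw (\<lambda>y. restrict y (A - S)) {y \<in> score_vectors t e (N + 1) A. full y = S}
        (score_vectors t e N (A - S))"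
    proof (rule bij_betw_byWitness[where f' = ?g])
      show "\<forall>y\<in>{y \<in> score_vectors t e (N + 1) A. full y = S}. ?g (restrict y (A - S)) = y"
        using S by (auto simp: full_def fun_eq_iff score_vectors_undefined)
      show "\<forall>z\<in>score_vectors t e N (A - S). restrict (?g z) (A - S) = z"
        by (auto simp: fun_eq_iff score_vectors_undefined)
      show "(\<lambda>y. restrict y (A - S)) ` {y \<in> score_vectors t e (N + 1) A. full y = S} \<subseteq> score_vectors t e N (A - S)"
      proof clarify
        fix y assume y: "y \<in> score_vectors t e (N + 1) A" and S_def: "S = full y"
        show "restrict y (A - full y) \<in> score_vectors t e N (A - full y)"
        proof (rule score_vectorsI)
          show "restrict y (A - full y) \<in> (A - full y) \<rightarrow>\<^sub>E {..N}"
          proof (rule PiE_I)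
            fix i assume "i \<in> A - full y"
            then show "restrict y (A - full y) i \<in> {..N}"
              using score_vectors_le[OF y, of i] by (auto simp: full_def)
          next
            fix i assume "i \<notin> A - full y"
            then show "restrict y (A - full y) i = undefined" unfolding restrict_apply by (rule if_not_P)
          qed
          fix R assume R: "R \<subseteq> A - full y" "R \<noteq> {}"
          then have "sum (restrict y (A - full y)) R = sum y R" by (intro sum.cong) auto
          then show "t * (card R choose 2) + e \<le> sum (restrict y (A - full y)) R"
            using score_vectors_sum_ge[OF y, of R] R by auto
        qed
      qed
      show "?g ` score_vectors t e N (A - S) \<subseteq> {y \<in> score_vectors t e (N + 1) A. full y = S}"
      proof clarify
        fix z assume z: "z \<in> score_vectors t e N (A - S)"
        have "?g z \<in> score_vectors t e (N + 1) A"
        proof (rule score_vectorsI)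
          show "?g z \<in> A \<rightarrow>\<^sub>E {..N + 1}"
          proof (rule PiE_I)
            fix i assume "i \<in> A"
            then show "?g z i \<in> {..N + 1}" using score_vectors_le[OF z, of i] by auto
          next
            fix i assume "i \<notin> A"
            then show "?g z i = undefined" using score_vectors_undefined[OF z, of i] S by auto
          qed
          fix R assume R: "R \<subseteq> A" "R \<noteq> {}"
          have fin: "finite R" using R A finite_subset by blast
          have "sum (?g z) R = sum (?g z) (R \<inter> S) + sum (?g z) (R - S)"
            using fin by (rule sum.Int_Diff)
          also have "sum (?g z) (R \<inter> S) = card (R \<inter> S) * (N + 1)" by simp
          also have "sum (?g z) (R - S) = sum z (R - S)" by (intro sum.cong) auto
          finally have sum: "sum (?g z) R = card (R \<inter> S) * (N + 1) + sum z (R - S)" .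
          have card: "card R = card (R \<inter> S) + card (R - S)"
            using fin by (metis card_Int_Diff)
          have rest: "t * (card (R - S) choose 2) + e \<le> sum z (R - S)" if "card (R - S) > 0"
          proof (rule score_vectors_sum_ge[OF z])
            show "R - S \<subseteq> A - S" using R by blast
            show "R - S \<noteq> {}" using that by force
          qed
          show "t * (card R choose 2) + e \<le> sum (?g z) R"
          proof (cases "R \<inter> S = {}")
            case True
            then have "R - S = R" by blast
            moreover have "card R > 0" using R fin by (simp add: card_gt_0_iff)
            ultimately show ?thesis using rest True unfolding sum by simp
          next
            case False
            then have "1 \<le> card (R \<inter> S)" using fin by (simp add: card_gt_0_iff Suc_le_eq)
            moreover have "card (R \<inter> S) + card (R - S) \<le> m"
              using card R A by (metis card_mono)
            ultimately show ?thesis unfolding sum card using full_entries_bound[OF N e _ _ rest] by blast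
          qed
        qed
        moreover have "full (?g z) = S"
        proof -
          have "z i \<noteq> N + 1" if "i \<in> A - S" for i
            using score_vectors_le[OF z that] by simp
          then show ?thesis using S by (auto simp: full_def)
        qed
        ultimately show "?g z \<in> score_vectors t e (N + 1) A \<and> full (?g z) = S" by blast
      qed
    qed
    then have "card {y \<in> score_vectors t e (N + 1) A. full y = S} = card (score_vectors t e N (A - S))"
      by (rule bij_betw_same_card)
    also have "\<dots> = num_scores t e N (m - card S)"
      using A S by (simp add: card_score_vectors card_Diff_subset finite_subset)
    finally show ?thesis .
  qed
  have "num_scores t e (N + 1) m = (\<Sum>y\<in>score_vectors t e (N + 1) A. 1)"
    by (simp add: num_scores_def A_def)
  also have "\<dots> = (\<Sum>S\<in>Pow A. 1 * card {y \<in> score_vectors t e (N + 1) A. full y = S})"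
    using sum_by_fibre[OF A(1) finite_score_vectors[OF A(1)], of t e "N + 1" full "\<lambda>_. 1"]
    by (simp add: full_def)
  also have "\<dots> = (\<Sum>S\<in>Pow A. num_scores t e N (m - card S))"
    using fibre by (intro sum.cong) auto
  also have "\<dots> = (\<Sum>k\<le>m. (m choose k) * num_scores t e N (m - k))"
    using sum_Pow_card[OF A(1), of "\<lambda>k. num_scores t e N (m - k)"] A(2) by simp
  finally show ?thesis .
qed

section \<open>Largest tight sets\<close>

definition is_tight :: "nat \<Rightarrow> ('a \<Rightarrow> nat) \<Rightarrow> 'a set \<Rightarrow> bool" where
  "is_tight t y S \<longleftrightarrow> sum y S = t * (card S choose 2)"

definition max_tight :: "nat \<Rightarrow> 'a set \<Rightarrow> ('a \<Rightarrow> nat) \<Rightarrow> 'a set" where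
  "max_tight t A y = \<Union>{S. S \<subseteq> A \<and> is_tight t y S}"

lemma max_tight_subset: "max_tight t A y \<subseteq> A"
  by (auto simp: max_tight_def)

text \<open>The function \<open>S \<mapsto> y(S) - t (|S| choose 2)\<close> is nonnegative and submodular, so its zeros are closed under union.\<close>

lemma tight_Un:
  assumes y: "y \<in> score_vectors t 0 N A" and A: "finite A"
    and S: "S \<subseteq> A" "is_tight t y S" and R: "R \<subseteq> A" "is_tight t y R"
  shows "is_tight t y (S \<union> R)"
proof -
  have fin: "finite S" "finite R" using S R A finite_subset by blast+
  define a b c where "a = card (S - R)" and "b = card (R - S)" and "c = card (S \<inter> R)"
  have cards: "card S = a + c" "card R = b + c" "card (S \<union> R) = a + c + b"
  proof -
    show "card S = a + c" using card_Int_Diff[OF fin(1), of R] by (simp add: a_def c_def)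
    then show "card (S \<union> R) = a + c + b"
      using card_Un_disjoint[of S "R - S"] fin by (simp add: b_def)
    show "card R = b + c" using card_Int_Diff[OF fin(2), of S] by (simp add: b_def c_def Int_commute)
  qed
  have "sum y (S \<union> R) + sum y (S \<inter> R) = sum y S + sum y R"
    using fin by (rule sum.union_inter)
  moreover have "t * (c choose 2) \<le> sum y (S \<inter> R)"
    unfolding c_def using score_vectors_sum_ge_0[OF y, of "S \<inter> R"] S by blast
  moreover have "t * (a + c + b choose 2) \<le> sum y (S \<union> R)"
    using score_vectors_sum_ge_0[OF y, of "S \<union> R"] S R by (simp add: cards)
  moreover have "t * (a + c + b choose 2) + t * (c choose 2) = t * (a + c choose 2) + t * (b + c choose 2) + t * (a * b)"
    by (simp add: choose_two_add algebra_simps)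
  ultimately show ?thesis
    using S(2) R(2) unfolding is_tight_def cards by linarith
qed

lemma max_tight_tight:
  assumes y: "y \<in> score_vectors t 0 N A" and A: "finite A"
  shows "is_tight t y (max_tight t A y)"
proof -
  have "is_tight t y (\<Union>F) \<and> \<Union>F \<subseteq> A" if "finite F" "F \<subseteq> {S. S \<subseteq> A \<and> is_tight t y S}" for F
    using that
  proof (induction F)
    case empty
    then show ?case by (simp add: is_tight_def numeral_2_eq_2)
  next
    case (insert S F)
    then show ?case using tight_Un[OF y A, of S "\<Union>F"] by auto
  qed
  moreover have "finite {S. S \<subseteq> A \<and> is_tight t y S}"
    by (rule finite_subset[of _ "Pow A"]) (use A in auto)
  ultimately show ?thesis unfolding max_tight_def by blast
qed

lemma tight_subset_max_tight: "S \<subseteq> A \<Longrightarrow> is_tight t y S \<Longrightarrow> S \<subseteq> max_tight t A y"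
  by (auto simp: max_tight_def)

text \<open>Let \<open>U\<close> be the largest tight set. The inequality for \<open>R \<union> U\<close> with \<open>R\<close> disjoint from \<open>U\<close> is strict and
loses \<open>t (|U| choose 2)\<close> on both sides; what remains, \<open>y(R) > t (|R| choose 2) + t |U| |R|\<close>, is a strict Landau
condition for \<open>y - t |U|\<close>. So \<open>y\<close> splits into a vector on \<open>U\<close> with tight total and a vector with strict
inequalities outside, and any two such vectors can be glued.\<close>

lemma card_max_tight_fibre:
  assumes A: "finite A" and U: "U \<subseteq> A" and N: "t * card A \<le> N"
  shows "card {y \<in> score_vectors t 0 N A. max_tight t A y = U}
       = num_tight_scores t (card U) * num_scores t 1 (N - t * card U) (card A - card U)"
proof -
  define u where "u = card U"
  have finU: "finite U" using A U finite_subset by blast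
  have u: "t * u \<le> N" using N card_mono[OF A U] unfolding u_def by (meson le_trans mult_le_mono2)
  let ?B = "{y \<in> score_vectors t 0 (t * u) U. sum y U = t * (u choose 2)}"
  let ?G = "score_vectors t 1 (N - t * u) (A - U)"
  let ?f = "\<lambda>y. (restrict y U, \<lambda>i\<in>A - U. y i - t * u)"
  let ?g = "\<lambda>(z, w) i. if i \<in> U then z i else if i \<in> A then w i + t * u else undefined"
  \<comment> \<open>The strict inequalities outside \<open>U\<close>: a further tight set \<open>R \<union> U\<close> would contradict maximality.\<close>
  have outside: "t * (card R choose 2) + card R * (t * u) + 1 \<le> sum y R"
    if y: "y \<in> score_vectors t 0 N A" "max_tight t A y = U" and R: "R \<subseteq> A - U" "R \<noteq> {}" for y R
  proof -
    have "R \<union> U \<subseteq> A" using R U by blast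
    then have "\<not> is_tight t y (R \<union> U)"
      using tight_subset_max_tight[of "R \<union> U" A t y] R y(2) by blast
    moreover have "t * (card (R \<union> U) choose 2) \<le> sum y (R \<union> U)"
      by (rule score_vectors_sum_ge_0[OF y(1) \<open>R \<union> U \<subseteq> A\<close>])
    moreover have "sum y U = t * (u choose 2)"
      using max_tight_tight[OF y(1) A] y(2) by (simp add: is_tight_def u_def)
    moreover have "finite R" using R A by (meson Diff_subset finite_subset)
    moreover have "R \<inter> U = {}" using R by blast
    ultimately show ?thesis
      using finU by (simp add: is_tight_def card_Un_disjoint sum.union_disjoint u_def[symmetric] choose_two_add algebra_simps)
  qed
  have "bij_betw ?f {y \<in> score_vectors t 0 N A. max_tight t A y = U} (?B \<times> ?G)"
  proof (rule bij_betw_byWitness[where f' = ?g])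
    have entry: "t * u + 1 \<le> y i" if "y \<in> score_vectors t 0 N A" "max_tight t A y = U" "i \<in> A - U" for y i
      using outside[OF that(1,2), of "{i}"] that(3) by (simp add: numeral_2_eq_2)
    show "\<forall>y\<in>{y \<in> score_vectors t 0 N A. max_tight t A y = U}. ?g (?f y) = y"
    proof
      fix y assume "y \<in> {y \<in> score_vectors t 0 N A. max_tight t A y = U}"
      then have y: "y \<in> score_vectors t 0 N A" and U': "U = max_tight t A y" by auto
      show "?g (?f y) = y"
      proof
        fix i
        show "?g (?f y) i = y i"
          using entry[OF y U'[symmetric], of i] score_vectors_undefined[OF y, of i] by auto
      qed
    qed
    show "\<forall>p\<in>?B \<times> ?G. ?f (?g p) = p"
    proof
      fix q assume "q \<in> ?B \<times> ?G"
      then obtain z w where q: "q = (z, w)" and z: "z \<in> score_vectors t 0 (t * u) U" and w: "w \<in> ?G"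
        by auto
      have "restrict (?g q) U = z"
      proof
        show "restrict (?g q) U i = z i" for i
          using score_vectors_undefined[OF z, of i] by (cases "i \<in> U") (simp_all add: q)
      qed
      moreover have "(\<lambda>i\<in>A - U. ?g q i - t * u) = w"
      proof
        show "(\<lambda>i\<in>A - U. ?g q i - t * u) i = w i" for i
          using score_vectors_undefined[OF w, of i] by (cases "i \<in> A - U") (simp_all add: q)
      qed
      ultimately show "?f (?g q) = q" by (simp only: q)
    qed
    show "?f ` {y \<in> score_vectors t 0 N A. max_tight t A y = U} \<subseteq> ?B \<times> ?G"
    proof (rule image_subsetI)
      fix y assume "y \<in> {y \<in> score_vectors t 0 N A. max_tight t A y = U}"
      then have y: "y \<in> score_vectors t 0 N A" and yU: "max_tight t A y = U" by auto
      have sumU: "sum y U = t * (u choose 2)"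
        using max_tight_tight[OF y A] yU by (simp add: is_tight_def u_def)
      have restrict: "sum (restrict y U) S = sum y S" if "S \<subseteq> U" for S
        using that by (intro sum.cong) auto
      have "restrict y U \<in> score_vectors t 0 (t * u) U"
      proof (rule score_vectorsI)
        \<comment> \<open>The other entries of \<open>U\<close> already sum to at least \<open>t (u - 1 choose 2)\<close>, and the total is \<open>t (u choose 2)\<close>.\<close>
        have "y i \<le> t * u" if i: "i \<in> U" for i
        proof -
          have "0 < u" using i finU by (auto simp: u_def card_gt_0_iff)
          then have "u = (u - 1) + 1" by simp
          then have "(u choose 2) = (u - 1 choose 2) + (u - 1)"
            using choose_two_add[of "u - 1" 1] by (simp add: numeral_2_eq_2)
          then have "t * (u choose 2) = t * (u - 1 choose 2) + t * (u - 1)"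
            by (simp add: distrib_left)
          moreover have "t * (card (U - {i}) choose 2) \<le> sum y (U - {i})"
            using U by (intro score_vectors_sum_ge_0[OF y]) auto
          moreover have "card (U - {i}) = u - 1" using i finU by (simp add: u_def)
          moreover have "sum y U = y i + sum y (U - {i})" using i finU by (simp add: sum.remove)
          ultimately have "y i \<le> t * (u - 1)" using sumU by simp
          also have "\<dots> \<le> t * u" by simp
          finally show ?thesis .
        qed
        then show "restrict y U \<in> U \<rightarrow>\<^sub>E {..t * u}" by auto
        fix S assume "S \<subseteq> U" "S \<noteq> {}"
        then show "t * (card S choose 2) + 0 \<le> sum (restrict y U) S"
          using score_vectors_sum_ge_0[OF y, of S] U restrict[of S] by auto
      qed
      moreover have "sum (restrict y U) U = t * (u choose 2)" using sumU restrict[of U] by simp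
      moreover have "(\<lambda>i\<in>A - U. y i - t * u) \<in> ?G"
      proof (rule score_vectorsI)
        show "(\<lambda>i\<in>A - U. y i - t * u) \<in> (A - U) \<rightarrow>\<^sub>E {..N - t * u}"
          using score_vectors_le[OF y] by (auto intro: diff_le_mono)
        fix R assume R: "R \<subseteq> A - U" "R \<noteq> {}"
        have "sum (\<lambda>i\<in>A - U. y i - t * u) R = (\<Sum>i\<in>R. y i - t * u)"
          using R by (intro sum.cong) auto
        also have "\<dots> = sum y R - card R * (t * u)"
          using entry[OF y yU] R by (subst sum_subtractf_nat) (auto simp: Suc_le_eq less_imp_le)
        finally show "t * (card R choose 2) + 1 \<le> sum (\<lambda>i\<in>A - U. y i - t * u) R"
          using outside[OF y yU R] by linarith
      qed
      ultimately show "?f y \<in> ?B \<times> ?G" by blast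
    qed
    show "?g ` (?B \<times> ?G) \<subseteq> {y \<in> score_vectors t 0 N A. max_tight t A y = U}"
    proof (rule image_subsetI)
      fix p assume "p \<in> ?B \<times> ?G"
      then obtain z w where p: "p = (z, w)" and z: "z \<in> score_vectors t 0 (t * u) U"
        and zU: "sum z U = t * (u choose 2)" and w: "w \<in> ?G" by auto
      define y where "y = ?g p"
      have sum: "sum y S = sum z (S \<inter> U) + (sum w (S - U) + card (S - U) * (t * u))" if S: "S \<subseteq> A" for S
      proof -
        have "finite S" using S A finite_subset by blast
        then have "sum y S = sum y (S \<inter> U) + sum y (S - U)" by (rule sum.Int_Diff)
        also have "sum y (S \<inter> U) = sum z (S \<inter> U)" by (intro sum.cong) (auto simp: y_def p)
        also have "sum y (S - U) = (\<Sum>i\<in>S - U. w i + t * u)"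
          using S by (intro sum.cong) (auto simp: y_def p)
        finally show ?thesis by (simp add: sum.distrib)
      qed
      have bound: "t * (card S choose 2) + (if S \<subseteq> U then 0 else 1) \<le> sum y S" if S: "S \<subseteq> A" for S
      proof -
        have fin: "finite S" using S A finite_subset by blast
        have "card S = card (S \<inter> U) + card (S - U)" using fin by (rule card_Int_Diff)
        then have "t * (card S choose 2) = t * (card (S \<inter> U) choose 2) + t * (card (S - U) choose 2)
            + card (S \<inter> U) * card (S - U) * t"
          by (simp add: choose_two_add algebra_simps)
        moreover have "card (S \<inter> U) * card (S - U) * t \<le> card (S - U) * (t * u)"
          using card_mono[OF finU, of "S \<inter> U"] by (simp add: u_def)
        moreover have "t * (card (S \<inter> U) choose 2) \<le> sum z (S \<inter> U)"
          by (intro score_vectors_sum_ge_0[OF z]) auto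
        moreover have "t * (card (S - U) choose 2) + (if S \<subseteq> U then 0 else 1) \<le> sum w (S - U)"
          using score_vectors_sum_ge[OF w, of "S - U"] score_vectors_sum_ge_0[OF w, of "S - U"] S
          by (cases "S \<subseteq> U") auto
        ultimately show ?thesis unfolding sum[OF S] by linarith
      qed
      have "y \<in> score_vectors t 0 N A"
      proof (rule score_vectorsI)
        show "y \<in> A \<rightarrow>\<^sub>E {..N}"
        proof (rule PiE_I)
          fix i assume i: "i \<in> A"
          show "y i \<in> {..N}"
          proof (cases "i \<in> U")
            case True
            then show ?thesis using score_vectors_le[OF z True] u by (simp add: y_def p)
          next
            case False
            then show ?thesis using score_vectors_le[OF w, of i] i u by (simp add: y_def p)
          qed
        qed (use U in \<open>auto simp: y_def p\<close>)
      next
        fix S assume "S \<subseteq> A" "S \<noteq> {}"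
        then show "t * (card S choose 2) + 0 \<le> sum y S" using bound[of S] by simp
      qed
      moreover have "max_tight t A y = U"
      proof
        have "is_tight t y U" using sum[OF U] zU by (simp add: is_tight_def u_def)
        then show "U \<subseteq> max_tight t A y" by (rule tight_subset_max_tight[OF U])
        show "max_tight t A y \<subseteq> U"
          unfolding max_tight_def
        proof (rule Union_least)
          fix S assume "S \<in> {S. S \<subseteq> A \<and> is_tight t y S}"
          then show "S \<subseteq> U" using bound[of S] by (auto simp: is_tight_def split: if_splits)
        qed
      qed
      ultimately show "?g p \<in> {y \<in> score_vectors t 0 N A. max_tight t A y = U}"
        by (simp only: y_def) blast
    qed
  qed
  then have "card {y \<in> score_vectors t 0 N A. max_tight t A y = U} = card ?B * card ?G"
    unfolding card_cartesian_product[symmetric] by (rule bij_betw_same_card)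
  also have "card ?B = num_tight_scores t (card U)"
    unfolding u_def by (rule card_base_vectors[OF finU])
  also have "card ?G = num_scores t 1 (N - t * card U) (card A - card U)"
    using A U finU by (simp add: card_score_vectors card_Diff_subset u_def)
  finally show ?thesis .
qed

lemma sum_over_max_tight:
  assumes A: "finite A" and N: "t * card A \<le> N"
  shows "(\<Sum>y\<in>score_vectors t 0 N A. F (card (max_tight t A y)))
       = (\<Sum>k\<le>card A. (card A choose k) * (F k * (num_tight_scores t k * num_scores t 1 (N - t * k) (card A - k))))"
proof -
  have "(\<Sum>y\<in>score_vectors t 0 N A. F (card (max_tight t A y)))
      = (\<Sum>U\<in>Pow A. F (card U) * card {y \<in> score_vectors t 0 N A. max_tight t A y = U})"
    by (rule sum_by_fibre[OF A finite_score_vectors[OF A], where h = "\<lambda>U. F (card U)"]) (rule max_tight_subset)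
  also have "\<dots> = (\<Sum>U\<in>Pow A. F (card U) * (num_tight_scores t (card U) * num_scores t 1 (N - t * card U) (card A - card U)))"
    using card_max_tight_fibre[OF A _ N] by (intro sum.cong) auto
  also have "\<dots> = (\<Sum>k\<le>card A. (card A choose k) * (F k * (num_tight_scores t k * num_scores t 1 (N - t * k) (card A - k))))"
    by (rule sum_Pow_card[OF A])
  finally show ?thesis .
qed

text \<open>Extend \<open>y\<close> by a coordinate \<open>p\<close>. Larger values only help, so the admissible values form an interval up to
\<open>N\<close>; its lower end is at most \<open>t |A|\<close>. The lower end is the only value that cannot be decreased, and what
prevents a decrease is a tight set through \<open>p\<close>. If the lower end is \<open>0\<close>, the singleton \<open>{p}\<close> is tight.\<close>

lemma extension_threshold:
  assumes A: "finite A" and p: "p \<notin> A" and N: "t * card A \<le> N" and y: "y \<in> score_vectors t 0 N A"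
  shows "\<exists>b\<le>N. (\<forall>v. y(p := v) \<in> score_vectors t 0 N (insert p A) \<longleftrightarrow> v \<in> {b..N}) \<and>
    (\<forall>v\<in>{b..N}. p \<in> max_tight t (insert p A) (y(p := v)) \<longleftrightarrow> v = b)"
proof -
  have sum: "sum (y(p := v)) (insert p S) = v + sum y S" if "S \<subseteq> A" for v S
  proof -
    have "finite S" "p \<notin> S" using that A p finite_subset by auto
    moreover have "sum (y(p := v)) S = sum y S" using \<open>p \<notin> S\<close> by (intro sum.cong) auto
    ultimately show ?thesis by simp
  qed
  have card: "card (insert p S) = Suc (card S)" if "S \<subseteq> A" for S
    using that A p finite_subset by (metis card_insert_disjoint subsetD)
  have mem: "y(p := v) \<in> score_vectors t 0 N (insert p A) \<longleftrightarrow>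
      v \<le> N \<and> (\<forall>S\<subseteq>A. t * (Suc (card S) choose 2) \<le> v + sum y S)" for v
  proof
    assume v: "y(p := v) \<in> score_vectors t 0 N (insert p A)"
    have "t * (Suc (card S) choose 2) \<le> v + sum y S" if "S \<subseteq> A" for S
    proof -
      have "insert p S \<subseteq> insert p A" using that by blast
      from score_vectors_sum_ge_0[OF v this] show ?thesis by (simp only: sum[OF that] card[OF that])
    qed
    then show "v \<le> N \<and> (\<forall>S\<subseteq>A. t * (Suc (card S) choose 2) \<le> v + sum y S)"
      using score_vectors_le[OF v, of p] by simp
  next
    assume v: "v \<le> N \<and> (\<forall>S\<subseteq>A. t * (Suc (card S) choose 2) \<le> v + sum y S)"
    show "y(p := v) \<in> score_vectors t 0 N (insert p A)"
    proof (rule score_vectorsI)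
      show "y(p := v) \<in> insert p A \<rightarrow>\<^sub>E {..N}"
      proof (rule PiE_I)
        fix i assume "i \<in> insert p A"
        then show "(y(p := v)) i \<in> {..N}" using v score_vectors_le[OF y, of i] by auto
      next
        fix i assume "i \<notin> insert p A"
        then show "(y(p := v)) i = undefined" using score_vectors_undefined[OF y, of i] by simp
      qed
      fix S assume S: "S \<subseteq> insert p A" "S \<noteq> {}"
      show "t * (card S choose 2) + 0 \<le> sum (y(p := v)) S"
      proof (cases "p \<in> S")
        case True
        then have S': "S = insert p (S - {p})" "S - {p} \<subseteq> A" using S by auto
        show ?thesis using v S'(2) card[OF S'(2)] sum[OF S'(2)] by (subst (1 2) S'(1)) simp
      next
        case False
        then have "S \<subseteq> A" using S by auto
        moreover have "sum (y(p := v)) S = sum y S" using False by (intro sum.cong) auto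
        ultimately show ?thesis using score_vectors_sum_ge_0[OF y, of S] by simp
      qed
    qed
  qed
  define ok where "ok v \<longleftrightarrow> (\<forall>S\<subseteq>A. t * (Suc (card S) choose 2) \<le> v + sum y S)" for v
  define b where "b = (LEAST v. ok v)"
  have "ok (t * card A)"
    unfolding ok_def
  proof clarify
    fix S assume S: "S \<subseteq> A"
    have "t * (Suc (card S) choose 2) = t * (card S choose 2) + t * card S"
      by (simp add: numeral_2_eq_2 distrib_left)
    moreover have "t * card S \<le> t * card A" using card_mono[OF A S] by simp
    ultimately show "t * (Suc (card S) choose 2) \<le> t * card A + sum y S"
      using score_vectors_sum_ge_0[OF y S] by linarith
  qed
  then have "ok b" and bN: "b \<le> t * card A"
    unfolding b_def by (rule LeastI) (rule Least_le, fact)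
  then have b: "t * (Suc (card S) choose 2) \<le> b + sum y S" if "S \<subseteq> A" for S
    using that by (simp add: ok_def)
  have valid: "y(p := v) \<in> score_vectors t 0 N (insert p A) \<longleftrightarrow> b \<le> v \<and> v \<le> N" for v
  proof
    assume "y(p := v) \<in> score_vectors t 0 N (insert p A)"
    then show "b \<le> v \<and> v \<le> N" unfolding mem b_def ok_def[symmetric] by (blast intro: Least_le)
  next
    assume "b \<le> v \<and> v \<le> N"
    then show "y(p := v) \<in> score_vectors t 0 N (insert p A)"
      unfolding mem using \<open>ok b\<close> unfolding ok_def by (meson add_le_mono1 le_trans)
  qed
  have tight: "p \<in> max_tight t (insert p A) (y(p := v)) \<longleftrightarrow> v = b" if v: "b \<le> v" "v \<le> N" for v
  proof
    assume "p \<in> max_tight t (insert p A) (y(p := v))"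
    then obtain S where S: "S \<subseteq> insert p A" "is_tight t (y(p := v)) S" "p \<in> S"
      by (auto simp: max_tight_def)
    then have S': "S = insert p (S - {p})" "S - {p} \<subseteq> A" by auto
    have "v + sum y (S - {p}) = t * (Suc (card (S - {p})) choose 2)"
      using S(2) sum[OF S'(2), of v] card[OF S'(2)] S'(1) by (simp add: is_tight_def)
    also have "\<dots> \<le> b + sum y (S - {p})" using b S'(2) by blast
    finally show "v = b" using v by simp
  next
    assume vb: "v = b"
    have "\<exists>S\<subseteq>A. t * (Suc (card S) choose 2) = b + sum y S"
    proof (cases "b = 0")
      case True
      then show ?thesis by (intro exI[of _ "{}"]) (simp add: numeral_2_eq_2)
    next
      case False
      then have "\<not> ok (b - 1)"
        using not_less_Least[of "b - 1" ok] by (simp add: b_def)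
      then obtain S where S: "S \<subseteq> A" "b - 1 + sum y S < t * (Suc (card S) choose 2)"
        by (auto simp: ok_def not_le)
      moreover have "t * (Suc (card S) choose 2) \<le> b + sum y S" using b S by blast
      ultimately show ?thesis using False by (intro exI[of _ S]) linarith
    qed
    then obtain S where S: "S \<subseteq> A" "t * (Suc (card S) choose 2) = b + sum y S" by blast
    then have "is_tight t (y(p := v)) (insert p S)"
      by (simp only: is_tight_def sum[OF S(1)] card[OF S(1)] vb)
    moreover have "insert p S \<subseteq> insert p A" using S by blast
    ultimately show "p \<in> max_tight t (insert p A) (y(p := v))"
      using tight_subset_max_tight by blast
  qed
  show ?thesis
  proof (intro exI[of _ b] conjI allI ballI)
    show "b \<le> N" using bN N by simp
    show "y(p := v) \<in> score_vectors t 0 N (insert p A) \<longleftrightarrow> v \<in> {b..N}" for v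
      by (simp add: valid)
    show "p \<in> max_tight t (insert p A) (y(p := v)) \<longleftrightarrow> v = b" if "v \<in> {b..N}" for v
      using that by (intro tight) auto
  qed
qed

text \<open>With \<open>b\<close> denoting the lower end of the interval of admissible values for \<open>p\<close>, a vector on \<open>A\<close> has \<open>N + 1 - b\<close>
extensions, exactly one of which has \<open>p\<close> in its largest tight set, with the value \<open>b\<close> at \<open>p\<close>. Adding up
eliminates \<open>b\<close>.\<close>

lemma sums_over_extensions:
  assumes A: "finite A" and p: "p \<notin> A" and N: "t * card A \<le> N"
  defines "Y \<equiv> score_vectors t 0 N (insert p A)"
  shows "(\<Sum>y\<in>Y. if p \<in> max_tight t (insert p A) y then 1 else 0) = card (score_vectors t 0 N A)"
    and "(\<Sum>y\<in>Y. if p \<in> max_tight t (insert p A) y then y p else 0) + card Y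
        = (N + 1) * card (score_vectors t 0 N A)"
proof -
  let ?X = "score_vectors t 0 N A"
  have "\<forall>x\<in>?X. \<exists>b. b \<le> N \<and> (\<forall>v. x(p := v) \<in> Y \<longleftrightarrow> v \<in> {b..N}) \<and>
      (\<forall>v\<in>{b..N}. p \<in> max_tight t (insert p A) (x(p := v)) \<longleftrightarrow> v = b)"
    unfolding Y_def using extension_threshold[OF A p N] by blast
  from bchoice[OF this] obtain b where "\<forall>x\<in>?X. b x \<le> N \<and> (\<forall>v. x(p := v) \<in> Y \<longleftrightarrow> v \<in> {b x..N}) \<and>
      (\<forall>v\<in>{b x..N}. p \<in> max_tight t (insert p A) (x(p := v)) \<longleftrightarrow> v = b x)" ..
  then have b: "b x \<le> N" "\<And>v. x(p := v) \<in> Y \<longleftrightarrow> v \<in> {b x..N}"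
    "\<And>v. v \<in> {b x..N} \<Longrightarrow> p \<in> max_tight t (insert p A) (x(p := v)) \<longleftrightarrow> v = b x"
    if "x \<in> ?X" for x
    using that by blast+
  have finX: "finite ?X" using A by (rule finite_score_vectors)
  have base: "restrict y A \<in> ?X" if "y \<in> Y" for y
  proof (rule score_vectorsI)
    have y: "y \<in> score_vectors t 0 N (insert p A)" using that by (simp add: Y_def)
    show "restrict y A \<in> A \<rightarrow>\<^sub>E {..N}" using score_vectors_le[OF y] by auto
    fix S assume S: "S \<subseteq> A" "S \<noteq> {}"
    then have "sum (restrict y A) S = sum y S" by (intro sum.cong) auto
    then show "t * (card S choose 2) + 0 \<le> sum (restrict y A) S"
      using score_vectors_sum_ge_0[OF y, of S] S by auto
  qed
  have extend: "(restrict y A)(p := y p) = y" if "y \<in> Y" for y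
    using score_vectors_undefined[of y t 0 N "insert p A"] that p by (auto simp: Y_def fun_eq_iff)
  have shrink: "restrict (x(p := v)) A = x" if "x \<in> ?X" for x v
    using score_vectors_undefined[OF that] p by (auto simp: fun_eq_iff)
  have fibred: "(\<Sum>y\<in>Y. h y) = (\<Sum>x\<in>?X. \<Sum>v\<in>{b x..N}. h (x(p := v)))" for h :: "('a \<Rightarrow> nat) \<Rightarrow> nat"
  proof -
    have "(\<Sum>y\<in>Y. h y) = (\<Sum>(x, v)\<in>Sigma ?X (\<lambda>x. {b x..N}). h (x(p := v)))"
    proof (rule sum.reindex_bij_witness[where i = "\<lambda>(x, v). x(p := v)" and j = "\<lambda>y. (restrict y A, y p)"])
      fix y assume y: "y \<in> Y"
      show "(case (restrict y A, y p) of (x, v) \<Rightarrow> x(p := v)) = y" using extend[OF y] by simp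
      show "(restrict y A, y p) \<in> Sigma ?X (\<lambda>x. {b x..N})"
        using b(2)[OF base[OF y], of "y p"] extend[OF y] y base[OF y] by simp
      show "(case (restrict y A, y p) of (x, v) \<Rightarrow> h (x(p := v))) = h y" using extend[OF y] by simp
    next
      fix q assume q: "q \<in> Sigma ?X (\<lambda>x. {b x..N})"
      then obtain x v where q': "q = (x, v)" "x \<in> ?X" "b x \<le> v" "v \<le> N" by auto
      then show "(case q of (x, v) \<Rightarrow> x(p := v)) \<in> Y" using b(2)[of x v] by simp
      show "(restrict (case q of (x, v) \<Rightarrow> x(p := v)) A, (case q of (x, v) \<Rightarrow> x(p := v)) p) = q"
        using q' shrink[of x v] by simp
    qed
    also have "\<dots> = (\<Sum>x\<in>?X. \<Sum>v\<in>{b x..N}. h (x(p := v)))"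
      using finX by (subst sum.Sigma) auto
    finally show ?thesis .
  qed
  have collapse: "(\<Sum>v\<in>{b x..N}. if p \<in> max_tight t (insert p A) (x(p := v)) then h v else 0) = h (b x)"
    if "x \<in> ?X" for x and h :: "nat \<Rightarrow> nat"
  proof -
    have "(\<Sum>v\<in>{b x..N}. if p \<in> max_tight t (insert p A) (x(p := v)) then h v else 0)
        = (\<Sum>v\<in>{b x..N}. if v = b x then h v else 0)"
      using b(3)[OF that] by (intro sum.cong) auto
    then show ?thesis using b(1)[OF that] by (simp add: sum.delta)
  qed
  show "(\<Sum>y\<in>Y. if p \<in> max_tight t (insert p A) y then 1 else 0) = card ?X"
    unfolding fibred using collapse[of _ "\<lambda>_. 1"] by simp
  have "(\<Sum>y\<in>Y. if p \<in> max_tight t (insert p A) y then y p else 0) = (\<Sum>x\<in>?X. b x)"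
    unfolding fibred fun_upd_same by (intro sum.cong refl) (rule collapse[of _ "\<lambda>v. v"])
  moreover have "card Y = (\<Sum>x\<in>?X. N + 1 - b x)"
    using fibred[of "\<lambda>_. 1"] by simp
  ultimately have "(\<Sum>y\<in>Y. if p \<in> max_tight t (insert p A) y then y p else 0) + card Y
      = (\<Sum>x\<in>?X. b x + (N + 1 - b x))" by (simp add: sum.distrib)
  also have "\<dots> = (\<Sum>x\<in>?X. N + 1)" using b(1) by (intro sum.cong) (auto simp: le_SucI)
  finally show "(\<Sum>y\<in>Y. if p \<in> max_tight t (insert p A) y then y p else 0) + card Y = (N + 1) * card ?X"
    by (simp add: mult.commute)
qed

text \<open>Summing over the choice of \<open>p\<close> turns the two counts for a single coordinate into the sums of \<open>|T(y)|\<close> and of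
\<open>y(T(y))\<close>. The second one is known by tightness, and this is what makes the count computable.\<close>

lemma max_tight_moments:
  assumes N: "t * m \<le> N" and A: "finite A" "card A = m"
  defines "Y \<equiv> score_vectors t 0 N A"
  shows "(\<Sum>y\<in>Y. card (max_tight t A y)) = m * num_scores t 0 N (m - 1)"
    and "(\<Sum>y\<in>Y. t * (card (max_tight t A y) choose 2)) + m * num_scores t 0 N m
        = m * ((N + 1) * num_scores t 0 N (m - 1))"
proof -
  have finT: "finite (max_tight t A y)" for y :: "'a \<Rightarrow> nat"
    using A(1) max_tight_subset finite_subset by metis
  have restrict: "(\<Sum>p\<in>A. if p \<in> max_tight t A y then h p else 0) = sum h (max_tight t A y)" for y and h :: "'a \<Rightarrow> nat"
    using A(1) max_tight_subset[of t A y] by (simp add: sum.If_cases Int_absorb1)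
  have point: "(\<Sum>y\<in>Y. if p \<in> max_tight t A y then 1 else 0) = num_scores t 0 N (m - 1)"
    "(\<Sum>y\<in>Y. if p \<in> max_tight t A y then y p else 0) + num_scores t 0 N m
      = (N + 1) * num_scores t 0 N (m - 1)" if p: "p \<in> A" for p
  proof -
    have A': "A = insert p (A - {p})" "finite (A - {p})" "p \<notin> A - {p}" "card (A - {p}) = m - 1"
      using A p by auto
    have N': "t * card (A - {p}) \<le> N"
      using N mult_le_mono2[of "m - 1" m t] unfolding A'(4) by linarith
    note ext = sums_over_extensions[OF A'(2,3) N']
    show "(\<Sum>y\<in>Y. if p \<in> max_tight t A y then 1 else 0) = num_scores t 0 N (m - 1)"
      using ext(1) A' by (simp add: Y_def card_score_vectors)
    show "(\<Sum>y\<in>Y. if p \<in> max_tight t A y then y p else 0) + num_scores t 0 N m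
      = (N + 1) * num_scores t 0 N (m - 1)"
      using ext(2) A' A by (simp add: Y_def card_score_vectors del: card_Diff_insert)
  qed
  have "(\<Sum>y\<in>Y. card (max_tight t A y)) = (\<Sum>y\<in>Y. \<Sum>p\<in>A. if p \<in> max_tight t A y then 1 else 0)"
    by (simp only: restrict card_eq_sum)
  also have "\<dots> = (\<Sum>p\<in>A. num_scores t 0 N (m - 1))"
    by (subst sum.swap) (intro sum.cong refl point(1))
  finally show "(\<Sum>y\<in>Y. card (max_tight t A y)) = m * num_scores t 0 N (m - 1)"
    using A by simp
  have "(\<Sum>y\<in>Y. t * (card (max_tight t A y) choose 2)) = (\<Sum>y\<in>Y. sum y (max_tight t A y))"
    using max_tight_tight[OF _ A(1), of _ t N] by (intro sum.cong) (auto simp: Y_def is_tight_def)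
  also have "\<dots> = (\<Sum>p\<in>A. \<Sum>y\<in>Y. if p \<in> max_tight t A y then y p else 0)"
    by (subst sum.swap) (simp only: restrict)
  finally have "(\<Sum>y\<in>Y. t * (card (max_tight t A y) choose 2)) + m * num_scores t 0 N m
      = (\<Sum>p\<in>A. (\<Sum>y\<in>Y. if p \<in> max_tight t A y then y p else 0) + num_scores t 0 N m)"
    using A by (simp add: sum.distrib)
  also have "\<dots> = (\<Sum>p\<in>A. (N + 1) * num_scores t 0 N (m - 1))"
    using point(2) by (intro sum.cong) auto
  finally show "(\<Sum>y\<in>Y. t * (card (max_tight t A y) choose 2)) + m * num_scores t 0 N m
        = m * ((N + 1) * num_scores t 0 N (m - 1))"
    using A by simp
qed

unbundle no vec_syntax
unbundle fps_syntax

section \<open>Exponentials of formal power series\<close>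

text \<open>The coefficient \<open>u\<^sub>0\<close> is invertible, so the equation determines the coefficients of the solution recursively.\<close>

lemma linear_ODE_unique:
  fixes u v f g :: "real fps"
  assumes f: "u * fps_deriv f = v * f" and g: "u * fps_deriv g = v * g"
    and u: "u $ 0 \<noteq> 0" and "f $ 0 = g $ 0"
  shows "f = g"
proof -
  define d where "d = f - g"
  have d: "u * fps_deriv d = v * d"
    using f g by (simp add: d_def algebra_simps)
  have "d $ n = 0" for n
  proof (induction n rule: less_induct)
    case (less n)
    show ?case
    proof (cases n)
      case 0
      then show ?thesis using assms(4) by (simp add: d_def)
    next
      case (Suc k)
      have "(v * d) $ k = 0"
        using less Suc by (simp add: fps_mult_nth)
      moreover have "(u * fps_deriv d) $ k = (\<Sum>i=0..k. if i = 0 then u $ 0 * (real (Suc k) * d $ Suc k) else 0)"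
        unfolding fps_mult_nth using less Suc by (intro sum.cong) auto
      ultimately show ?thesis using d u Suc by (simp add: sum.delta)
    qed
  qed
  then show ?thesis by (simp add: d_def fps_eq_iff)
qed

definition fexp :: "real fps \<Rightarrow> real fps" where
  "fexp q = fps_exp 1 oo q"

lemma fexp_nth_0 [simp]: "fexp q $ 0 = 1"
  by (simp add: fexp_def)

lemma fexp_deriv: "q $ 0 = 0 \<Longrightarrow> fps_deriv (fexp q) = fps_deriv q * fexp q"
  by (simp add: fexp_def fps_compose_deriv mult.commute)

lemma fexp_unique:
  assumes "q $ 0 = 0" "fps_deriv f = fps_deriv q * f" "f $ 0 = 1"
  shows "f = fexp q"
  by (rule linear_ODE_unique[where u = 1 and v = "fps_deriv q"]) (use assms in \<open>simp_all add: fexp_deriv\<close>)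

lemma fexp_add: "p $ 0 = 0 \<Longrightarrow> q $ 0 = 0 \<Longrightarrow> fexp (p + q) = fexp p * fexp q"
  by (rule fexp_unique[symmetric]) (simp_all add: fexp_deriv algebra_simps)

lemma fps_exp_eq_fexp: "fps_exp a = fexp (fps_const a * fps_X)"
  by (rule fexp_unique) simp_all

lemma fexp_compose: "q $ 0 = 0 \<Longrightarrow> r $ 0 = 0 \<Longrightarrow> fexp q oo r = fexp (q oo r)"
  by (simp add: fexp_def fps_compose_assoc)

text \<open>The series of \<open>- ln (1 - X)\<close>; the constant coefficient is \<open>0\<close> since \<open>1 / 0 = 0\<close>.\<close>

definition logser :: "real fps" where
  "logser = Abs_fps (\<lambda>k. 1 / real k)"

lemma logser_nth_0 [simp]: "logser $ 0 = 0"
  by (simp add: logser_def)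

lemma logser_deriv: "(1 - fps_X) * fps_deriv logser = 1"
proof -
  have "fps_deriv logser = Abs_fps (\<lambda>_. 1)"
    by (simp add: fps_eq_iff logser_def)
  then show ?thesis
    by (metis fps_inverse_gp' inverse_mult_eq_1' fps_nth_Abs_fps zero_neq_one mult.commute)
qed

section \<open>Exponential generating functions of the counts\<close>

lemma egf_mult_nth:
  fixes a b :: "nat \<Rightarrow> real"
  shows "fact m * (Abs_fps (\<lambda>k. a k / fact k) * Abs_fps (\<lambda>k. b k / fact k)) $ m
       = (\<Sum>k\<le>m. real (m choose k) * a k * b (m - k))"
  unfolding fps_mult_nth sum_distrib_left atLeast0AtMost
  by (intro sum.cong) (auto simp: binomial_fact field_simps)

text \<open>The recursion says that the generating function \<open>A N\<close> satisfies \<open>A (N + 1) = exp(X) A N\<close>, but for fixed \<open>N\<close>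
only in low degrees. Hence each coefficient of \<open>exp(- N X) A N\<close> is eventually independent of \<open>N\<close>, and
\<open>c\<close> collects the stable values.\<close>

lemma appell_sequence_egf:
  fixes a :: "nat \<Rightarrow> nat \<Rightarrow> real" and t :: nat
  assumes step: "\<And>N m. t * (m - 1) \<le> N + 1 \<Longrightarrow>
      a (N + 1) m = (\<Sum>k\<le>m. real (m choose k) * a N (m - k))"
  shows "\<exists>c. \<forall>N m. t * (m - 1) \<le> N + 1 \<longrightarrow> a N m = fact m * (fps_exp (real N) * c) $ m"
proof -
  define A where "A N = Abs_fps (\<lambda>m. a N m / fact m)" for N
  define e where "e N m = (fps_exp (- real N) * A N) $ m" for N m
  have A_Suc: "A (Suc N) $ m = (fps_exp 1 * A N) $ m" if "t * (m - 1) \<le> N + 1" for N m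
  proof -
    have "fact m * (fps_exp 1 * A N) $ m = a (Suc N) m"
      using egf_mult_nth[of m "\<lambda>_. 1" "a N"] step[OF that] by (simp add: fps_exp_def A_def)
    then show ?thesis by (simp add: A_def field_simps)
  qed
  have e_Suc: "e (Suc N) m = e N m" if "t * (m - 1) \<le> N + 1" for N m
  proof -
    have "e (Suc N) m = (\<Sum>i=0..m. fps_exp (- real (Suc N)) $ i * (fps_exp 1 * A N) $ (m - i))"
      unfolding e_def fps_mult_nth[of "fps_exp (- real (Suc N))"]
    proof (rule sum.cong[OF refl])
      fix i assume "i \<in> {0..m}"
      have "t * (m - i - 1) \<le> N + 1"
        using that by (meson diff_le_mono diff_le_self le_trans mult_le_mono2)
      then show "fps_exp (- real (Suc N)) $ i * A (Suc N) $ (m - i) =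
          fps_exp (- real (Suc N)) $ i * (fps_exp 1 * A N) $ (m - i)"
        by (simp add: A_Suc)
    qed
    also have "\<dots> = ((fps_exp (- real (Suc N)) * fps_exp 1) * A N) $ m"
      by (simp only: fps_mult_nth[of "fps_exp (- real (Suc N))"] mult.assoc)
    also have "fps_exp (- real (Suc N)) * fps_exp 1 = fps_exp (- real N)"
      by (subst fps_exp_add_mult[symmetric]) simp
    finally show ?thesis by (simp add: e_def)
  qed
  define c where "c = Abs_fps (\<lambda>m. e (t * (m - 1) - 1) m)"
  have e_c: "e N m = c $ m" if "t * (m - 1) \<le> N + 1" for N m
  proof -
    have "t * (m - 1) - 1 \<le> N" using that by simp
    then have "e N m = e (t * (m - 1) - 1) m"
    proof (induction N rule: dec_induct)
      case (step n)
      then show ?case using e_Suc[of m n] by linarith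
    qed simp
    then show ?thesis by (simp add: c_def)
  qed
  have "a N m = fact m * (fps_exp (real N) * c) $ m" if "t * (m - 1) \<le> N + 1" for N m
  proof -
    have "fps_exp (real N) * fps_exp (- real N) = 1"
      by (simp add: fps_exp_add_mult[symmetric])
    then have "A N $ m = (fps_exp (real N) * (fps_exp (- real N) * A N)) $ m"
      by (simp add: mult.assoc[symmetric])
    also have "\<dots> = (\<Sum>i=0..m. fps_exp (real N) $ i * e N (m - i))"
      by (simp add: e_def fps_mult_nth[of "fps_exp (real N)"])
    also have "\<dots> = (\<Sum>i=0..m. fps_exp (real N) $ i * c $ (m - i))"
    proof (rule sum.cong[OF refl])
      fix i assume "i \<in> {0..m}"
      have "t * (m - i - 1) \<le> N + 1"
        using that by (meson diff_le_mono diff_le_self le_trans mult_le_mono2)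
      then show "fps_exp (real N) $ i * e N (m - i) = fps_exp (real N) $ i * c $ (m - i)"
        by (simp add: e_c)
    qed
    also have "\<dots> = (fps_exp (real N) * c) $ m" by (simp add: fps_mult_nth)
    finally show ?thesis by (simp add: A_def field_simps)
  qed
  then show ?thesis by blast
qed

text \<open>Here \<open>c\<close>, \<open>g\<close> and \<open>h\<close> are the generating functions for weak inequalities, strict inequalities and tight totals,
and \<open>\<zeta> = X exp(- t X)\<close> accounts for the shift by \<open>t |U|\<close> outside a tight set \<open>U\<close>. The three hypotheses
translate the count by largest tight sets and the two moments. The first two determine \<open>h \<circ> \<zeta> = c / g\<close>; the third
one expresses \<open>c'\<close> by \<open>c\<close> and the second derivative of \<open>h\<close> at \<open>\<zeta>\<close>, which is then known. The solutions are
\<open>(1 - t X)\<^bsup>1/2\<^esup>\<close> times exponentials of polynomials.\<close>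

lemma tight_set_system_solution:
  fixes t :: real and c g h :: "real fps"
  defines "T \<equiv> fps_const t" and "\<zeta> \<equiv> fps_X * fps_exp (- t)"
  assumes total: "c = (h oo \<zeta>) * g"
    and size: "((fps_X * fps_deriv h) oo \<zeta>) * g = fps_X * c"
    and sum: "fps_const (t / 2) * ((fps_X\<^sup>2 * fps_deriv (fps_deriv h)) oo \<zeta>) * g
              = fps_X * (c - fps_deriv c)"
    and g0: "g $ 0 = 1" and h0: "h $ 0 = 1"
  shows "c = fexp (fps_const (1 + t / 2) * fps_X - fps_const (t / 4) * fps_X\<^sup>2
                   - fps_const (1 / 2) * (logser oo (T * fps_X)))"
    and "g = fexp (fps_const (t / 2) * fps_X + fps_const (t / 4) * fps_X\<^sup>2
                   - fps_const (1 / 2) * (logser oo (T * fps_X)))"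
proof -
  define K where "K = h oo \<zeta>"
  define H1 where "H1 = fps_deriv h oo \<zeta>"
  define H2 where "H2 = fps_deriv (fps_deriv h) oo \<zeta>"
  define E where "E = fps_exp t"
  define E' where "E' = fps_exp (- t)"
  have EE': "E * E' = 1"
    by (simp add: E_def E'_def fps_exp_add_mult[symmetric])
  have \<zeta>0: "\<zeta> $ 0 = 0" by (simp add: \<zeta>_def)
  have \<zeta>: "\<zeta> = fps_X * E'" by (simp add: \<zeta>_def E'_def)
  have \<zeta>': "fps_deriv \<zeta> = E' * (1 - T * fps_X)"
    by (simp add: \<zeta>_def E'_def T_def algebra_simps fps_const_neg[symmetric] del: fps_const_neg)
  have g: "g \<noteq> 0" using g0 by auto
  have c0: "c $ 0 = 1" by (simp add: total h0 g0)
  have K0: "K $ 0 = 1" by (simp add: K_def h0)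
  \<comment> \<open>The first two hypotheses give \<open>h' \<circ> \<zeta> = exp(t X) (h \<circ> \<zeta>)\<close>, a differential equation for \<open>K = h \<circ> \<zeta>\<close>.\<close>
  have "\<zeta> * H1 * g = fps_X * (K * g)"
    using size total by (simp add: fps_compose_mult_distrib[OF \<zeta>0] \<zeta>0 H1_def K_def)
  then have "(fps_X * g) * (E' * H1) = (fps_X * g) * K" by (simp add: \<zeta> algebra_simps)
  then have "E' * H1 = K" using g by (metis fps_X_neq_zero mult_cancel_left mult_eq_0_iff)
  then have H1: "H1 = E * K" using EE' by (metis mult.assoc mult.left_neutral)
  have "fps_deriv K = H1 * fps_deriv \<zeta>"
    by (simp add: K_def H1_def fps_compose_deriv[OF \<zeta>0])
  then have K': "fps_deriv K = (1 - T * fps_X) * K"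
    using EE' unfolding H1 \<zeta>' by algebra
  have K_eq: "K = fexp (fps_X - fps_const (t / 2) * fps_X\<^sup>2)"
  proof (rule fexp_unique)
    have "fps_deriv (fps_X - fps_const (t / 2) * fps_X\<^sup>2) = 1 - T * fps_X"
      by (simp add: T_def fps_deriv_power fps_eq_iff)
    then show "fps_deriv K = fps_deriv (fps_X - fps_const (t / 2) * fps_X\<^sup>2) * K"
      using K' by simp
  qed (simp_all add: K0)
  \<comment> \<open>Differentiating once more yields \<open>h'' \<circ> \<zeta>\<close>.\<close>
  have "fps_deriv H1 = H2 * fps_deriv \<zeta>"
    by (simp add: H1_def H2_def fps_compose_deriv[OF \<zeta>0])
  moreover have "fps_deriv H1 = E * (K * (1 + T - T * fps_X))"
    by (simp add: H1 K') (simp add: E_def T_def algebra_simps)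
  ultimately have "H2 * E' * (1 - T * fps_X) = E * (K * (1 + T - T * fps_X))"
    by (simp add: \<zeta>' algebra_simps)
  then have H2: "E' * E' * H2 * (1 - T * fps_X) = K * (1 + T - T * fps_X)"
    using EE' by algebra
  have sum': "fps_const (t / 2) * (\<zeta>\<^sup>2 * H2) * g = fps_X * (c - fps_deriv c)"
    using sum by (simp add: fps_compose_mult_distrib[OF \<zeta>0] fps_compose_power[OF \<zeta>0, symmetric] \<zeta>0 H2_def)
  then have "fps_X * (fps_const (t / 2) * fps_X * (E' * E' * H2 * (1 - T * fps_X)) * g)
       = fps_X * ((1 - T * fps_X) * (c - fps_deriv c))"
    by (simp add: \<zeta> power2_eq_square) (simp add: mult_ac)
  then have "fps_const (t / 2) * fps_X * (K * (1 + T - T * fps_X)) * g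
       = (1 - T * fps_X) * (c - fps_deriv c)"
    unfolding H2 by (simp only: mult_cancel_left fps_X_neq_zero simp_thms)
  then have c': "(1 - T * fps_X) * fps_deriv c
      = ((1 - T * fps_X) - fps_const (t / 2) * fps_X * (1 + T - T * fps_X)) * c"
    unfolding total K_def[symmetric] by (simp add: algebra_simps)
  \<comment> \<open>It remains to check that the claimed exponential satisfies the equation found for \<open>c\<close>.\<close>
  define L where "L = logser oo (T * fps_X)"
  have L0: "L $ 0 = 0" by (simp add: L_def)
  have "((1 - fps_X) * fps_deriv logser) oo (T * fps_X) = 1"
    by (simp add: logser_deriv)
  then have "(1 - T * fps_X) * (fps_deriv logser oo (T * fps_X)) = 1"
    by (simp add: fps_compose_mult_distrib fps_compose_sub_distrib)
  moreover have "fps_deriv L = (fps_deriv logser oo (T * fps_X)) * T"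
    by (simp add: L_def T_def fps_compose_deriv)
  ultimately have L': "(1 - T * fps_X) * fps_deriv L = T"
    by (simp add: mult.assoc[symmetric])
  define q where "q = fps_const (1 + t / 2) * fps_X - fps_const (t / 4) * fps_X\<^sup>2 - fps_const (1 / 2) * L"
  have q0: "q $ 0 = 0" by (simp add: q_def L0)
  define W where "W = fps_const (t / 2)"
  have T: "T = W + W" by (simp add: T_def W_def)
  have half: "fps_const (1 / 2) * T = W" by (simp add: T_def W_def)
  have deriv_q: "fps_deriv q = 1 + W - W * fps_X - fps_const (1 / 2) * fps_deriv L"
    by (simp add: q_def W_def fps_deriv_power fps_eq_iff)
  have "(1 - T * fps_X) * fps_deriv q = (1 - T * fps_X) * (1 + W - W * fps_X) - fps_const (1 / 2) * ((1 - T * fps_X) * fps_deriv L)"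
    unfolding deriv_q by (simp add: algebra_simps)
  also have "\<dots> = (1 - T * fps_X) * (1 + W - W * fps_X) - W"
    unfolding L' half ..
  also have "\<dots> = (1 - T * fps_X) - W * fps_X * (1 + T - T * fps_X)"
    unfolding T by (simp add: algebra_simps)
  finally have q': "(1 - T * fps_X) * fps_deriv q = (1 - T * fps_X) - fps_const (t / 2) * fps_X * (1 + T - T * fps_X)"
    by (simp add: W_def)
  have "c = fexp q"
  proof (rule linear_ODE_unique[OF c'])
    show "(1 - T * fps_X) * fps_deriv (fexp q)
      = ((1 - T * fps_X) - fps_const (t / 2) * fps_X * (1 + T - T * fps_X)) * fexp q"
      unfolding q'[symmetric] by (simp add: fexp_deriv[OF q0])
  qed (simp_all add: c0 T_def)
  then show "c = fexp (fps_const (1 + t / 2) * fps_X - fps_const (t / 4) * fps_X\<^sup>2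
                   - fps_const (1 / 2) * (logser oo (T * fps_X)))"
    by (simp add: q_def L_def)
  define r where "r = fps_const (t / 2) * fps_X + fps_const (t / 4) * fps_X\<^sup>2 - fps_const (1 / 2) * L"
  have "q = (fps_X - fps_const (t / 2) * fps_X\<^sup>2) + r"
    by (simp add: q_def r_def fps_eq_iff algebra_simps)
  moreover have "r $ 0 = 0" by (simp add: r_def L0)
  ultimately have "fexp q = K * fexp r"
    using K_eq by (simp add: fexp_add)
  with \<open>c = fexp q\<close> total have "K * g = K * fexp r" by (simp add: K_def)
  moreover have "K \<noteq> 0" using K0 by auto
  ultimately have "g = fexp r" by simp
  then show "g = fexp (fps_const (t / 2) * fps_X + fps_const (t / 4) * fps_X\<^sup>2
                   - fps_const (1 / 2) * (logser oo (T * fps_X)))"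
    by (simp add: r_def L_def)
qed

section \<open>Lagrange inversion and the magic basis\<close>

lemma fps_compose_mult_nth:
  fixes a b c :: "real fps"
  assumes "b $ 0 = 0"
  shows "((a oo b) * c) $ m = (\<Sum>k\<le>m. a $ k * (b ^ k * c) $ m)"
proof -
  have "((a oo b) * c) $ m = (\<Sum>i\<le>m. (\<Sum>k\<le>m. a $ k * (b ^ k) $ i) * c $ (m - i))"
    unfolding fps_mult_nth atLeast0AtMost
  proof (rule sum.cong[OF refl])
    fix i assume "i \<in> {..m}"
    then have "(\<Sum>k\<le>m. a $ k * (b ^ k) $ i) = (\<Sum>k\<in>{0..i}. a $ k * (b ^ k) $ i)"
      by (intro sum.mono_neutral_right) (auto simp: startsby_zero_power_prefix[OF assms])
    then show "(a oo b) $ i * c $ (m - i) = (\<Sum>k\<le>m. a $ k * (b ^ k) $ i) * c $ (m - i)"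
      by (simp add: fps_compose_nth)
  qed
  also have "\<dots> = (\<Sum>k\<le>m. \<Sum>i\<le>m. a $ k * ((b ^ k) $ i * c $ (m - i)))"
    by (subst sum.swap) (simp add: sum_distrib_right mult.assoc)
  also have "\<dots> = (\<Sum>k\<le>m. a $ k * (b ^ k * c) $ m)"
    by (simp add: fps_mult_nth atLeast0AtMost sum_distrib_left)
  finally show ?thesis .
qed

text \<open>The compositional inverse of Cayley's tree function \<open>\<Sum> k\<^bsup>k-1\<^esup> X\<^sup>k / k!\<close>.\<close>

definition tree_inverse :: "real fps" where
  "tree_inverse = fps_X * fps_exp (- 1)"

lemma tree_inverse_nth_0 [simp]: "tree_inverse $ 0 = 0"
  by (simp add: tree_inverse_def)

text \<open>Lagrange inversion for \<open>X exp(- X)\<close>, with the composition on the known side so that no inverse series appears.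
By linearity it suffices to take \<open>\<phi> = X\<^sup>k\<close>, where the claim is \<open>d\<^sup>d / d! = d\<^bsup>d-1\<^esup> / (d - 1)!\<close> for
\<open>d = m - k > 0\<close>.\<close>

lemma lagrange_coefficient:
  "((\<phi> oo tree_inverse) * ((1 - fps_X) * fps_exp (real m))) $ m = \<phi> $ m"
proof -
  have "(tree_inverse ^ k * ((1 - fps_X) * fps_exp (real m))) $ m = (if k = m then 1 else 0)"
    if "k \<le> m" for k
  proof -
    define d where "d = m - k"
    have "tree_inverse ^ k * ((1 - fps_X) * fps_exp (real m))
        = fps_X ^ k * ((1 - fps_X) * (fps_exp (- real k) * fps_exp (real m)))"
      by (simp add: tree_inverse_def power_mult_distrib fps_exp_power_mult mult_ac)
    also have "fps_exp (- real k) * fps_exp (real m) = fps_exp (real d)"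
      using that by (simp add: fps_exp_add_mult[symmetric] d_def of_nat_diff)
    finally have "(tree_inverse ^ k * ((1 - fps_X) * fps_exp (real m))) $ m
        = (fps_X ^ k * ((1 - fps_X) * fps_exp (real d))) $ m" by (rule arg_cong)
    also have "\<dots> = ((1 - fps_X) * fps_exp (real d)) $ d"
      using that by (simp only: fps_X_power_mult_nth d_def if_False not_less[symmetric])
    also have "\<dots> = (if d = 0 then 1 else 0)"
    proof (cases d)
      case (Suc k)
      have "real (Suc k) ^ Suc k / fact (Suc k) = real (Suc k) ^ k / fact k"
        by (simp del: of_nat_Suc)
      then show ?thesis
        by (simp add: left_diff_distrib Suc del: of_nat_Suc fact_Suc power_Suc)
    qed simp
    finally show ?thesis using that by (auto simp: d_def)
  qed
  then have "(\<Sum>k\<le>m. \<phi> $ k * (tree_inverse ^ k * ((1 - fps_X) * fps_exp (real m))) $ m)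
      = (\<Sum>k\<le>m. if k = m then \<phi> $ k else 0)"
    by (intro sum.cong) auto
  then show ?thesis
    by (simp add: fps_compose_mult_nth sum.delta)
qed

lemma tree_inverse_factor: "\<exists>\<phi>. f = \<phi> oo tree_inverse"
proof
  have "tree_inverse $ 1 \<noteq> 0" by (simp add: tree_inverse_def)
  then have "fps_inv tree_inverse oo tree_inverse = fps_X"
    by (intro fps_inv) simp_all
  then show "f = (f oo fps_inv tree_inverse) oo tree_inverse"
    by (subst fps_compose_assoc[symmetric]) (simp_all add: fps_inv_def)
qed

abbreviation magic_base :: "real fps" where
  "magic_base \<equiv> fps_X - fps_const (1 / 4) * fps_X\<^sup>2"

text \<open>The logarithm of \<open>(1 - X)\<^bsup>1/2\<^esup> exp((n - 1/2) X + X\<^sup>2 / 4)\<close>. At \<open>n = N + 1\<close> it is the exponent in the generating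
function of the strict count for \<open>t = 1\<close>.\<close>

definition magic_log :: "real \<Rightarrow> real fps" where
  "magic_log n = fps_const (n - 1 / 2) * fps_X + fps_const (1 / 4) * fps_X\<^sup>2
     - fps_const (1 / 2) * logser"

lemma magic_log_nth_0 [simp]: "magic_log n $ 0 = 0"
  by (simp add: magic_log_def)

text \<open>Substitute \<open>X / t\<close> for \<open>X\<close> and put \<open>w = (t + 1) / t\<close>. The exponent is linear in \<open>1 / t = w - 1\<close>, and the factor
of \<open>w\<close> is \<open>X - X\<^sup>2 / 4\<close>. Expanding the exponential in powers of \<open>w\<close> gives the magic basis, because
\<open>t\<^sup>m w\<^sup>j = t\<^bsup>m-j\<^esup> (t + 1)\<^sup>j\<close>.\<close>

lemma magic_expansion:
  fixes t n :: real
  assumes "t > 0"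
  shows "fexp (fps_const (t * n + 1 + t / 2) * fps_X - fps_const (t / 4) * fps_X\<^sup>2
               - fps_const (1 / 2) * (logser oo (fps_const t * fps_X))) $ m
       = (\<Sum>j\<le>m. (magic_base ^ j * fexp (magic_log n)) $ m / fact j * (t ^ (m - j) * (t + 1) ^ j))"
proof -
  define w where "w = 1 + 1 / t"
  define Q where "Q = fps_const w * magic_base + magic_log n"
  have Q0: "Q $ 0 = 0" by (simp add: Q_def)
  have "Q oo (fps_const t * fps_X) = fps_const (t * n + 1 + t / 2) * fps_X - fps_const (t / 4) * fps_X\<^sup>2
               - fps_const (1 / 2) * (logser oo (fps_const t * fps_X))"
    unfolding fps_compose_linear fps_eq_iff
  proof
    fix k :: nat
    consider "k = 1" | "k = 2" | "k \<noteq> 1" "k \<noteq> 2" by blast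
    then show "Abs_fps (\<lambda>k. t ^ k * Q $ k) $ k = (fps_const (t * n + 1 + t / 2) * fps_X
        - fps_const (t / 4) * fps_X\<^sup>2 - fps_const (1 / 2) * Abs_fps (\<lambda>k. t ^ k * logser $ k)) $ k"
    proof cases
      case 1
      then show ?thesis using assms by (simp add: Q_def magic_log_def w_def field_simps)
    next
      case 2
      then show ?thesis using assms by (simp add: Q_def magic_log_def w_def field_simps power2_eq_square[of t])
    next
      case 3
      then show ?thesis by (simp add: Q_def magic_log_def fps_X_nth fps_X_power_nth)
    qed
  qed
  then have "fexp (fps_const (t * n + 1 + t / 2) * fps_X - fps_const (t / 4) * fps_X\<^sup>2
               - fps_const (1 / 2) * (logser oo (fps_const t * fps_X))) $ m
     = (fexp Q oo (fps_const t * fps_X)) $ m"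
    by (simp add: fexp_compose Q0)
  also have "\<dots> = t ^ m * fexp Q $ m"
    by (simp add: fps_compose_linear)
  also have "fexp Q = (fps_exp w oo magic_base) * fexp (magic_log n)"
    by (simp add: Q_def fexp_add fps_exp_eq_fexp fexp_compose fps_compose_mult_distrib)
  also have "t ^ m * \<dots> $ m = (\<Sum>j\<le>m. t ^ m * (w ^ j / fact j * (magic_base ^ j * fexp (magic_log n)) $ m))"
    by (simp add: fps_compose_mult_nth sum_distrib_left)
  also have "\<dots> = (\<Sum>j\<le>m. (magic_base ^ j * fexp (magic_log n)) $ m / fact j * (t ^ (m - j) * (t + 1) ^ j))"
  proof (rule sum.cong[OF refl])
    fix j assume "j \<in> {..m}"
    then have "t ^ m = t ^ (m - j) * t ^ j" by (simp add: power_add[symmetric])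
    moreover have "t ^ j * w ^ j = (t + 1) ^ j"
      using assms by (simp add: w_def power_mult_distrib[symmetric] field_simps)
    ultimately have eq: "t ^ m * w ^ j = t ^ (m - j) * (t + 1) ^ j" by simp
    show "t ^ m * (w ^ j / fact j * (magic_base ^ j * fexp (magic_log n)) $ m) =
      (magic_base ^ j * fexp (magic_log n)) $ m / fact j * (t ^ (m - j) * (t + 1) ^ j)"
      unfolding eq[symmetric] by (simp add: mult_ac)
  qed
  finally show ?thesis .
qed

definition fps_nonneg :: "real fps \<Rightarrow> bool" where
  "fps_nonneg f \<longleftrightarrow> (\<forall>k. 0 \<le> f $ k)"

lemma fps_nonneg_mult: "fps_nonneg f \<Longrightarrow> fps_nonneg g \<Longrightarrow> fps_nonneg (f * g)"
  by (simp add: fps_nonneg_def fps_mult_nth sum_nonneg)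

lemma fps_nonneg_power: "fps_nonneg f \<Longrightarrow> fps_nonneg (f ^ k)"
proof (induction k)
  case 0
  then show ?case by (simp add: fps_nonneg_def)
qed (simp add: fps_nonneg_mult)

text \<open>The coefficients of \<open>\<alpha>\<close> are \<open>k\<^bsup>k-2\<^esup> (k + 1) / (2 k!)\<close> by Lagrange inversion. Positivity in the end rests on their
growth: they are \<open>1\<close>, \<open>3/4\<close> and then nondecreasing, and the drop from the first to the second one is the source
of the exceptional case.\<close>

lemma magic_base_factor:
  obtains \<alpha> where "magic_base = \<alpha> oo tree_inverse" "\<alpha> $ 0 = 0" "\<alpha> $ 1 = 1" "\<alpha> $ 2 = 3 / 4"
    "\<And>k. 2 \<le> k \<Longrightarrow> \<alpha> $ k \<le> \<alpha> $ Suc k"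
proof -
  obtain \<alpha> where \<alpha>: "magic_base = \<alpha> oo tree_inverse" using tree_inverse_factor by blast
  have "magic_base * ((1 - fps_X) * fps_exp (real m)) = fps_X * fps_exp (real m)
      - fps_const (5 / 4) * (fps_X\<^sup>2 * fps_exp (real m)) + fps_const (1 / 4) * (fps_X ^ 3 * fps_exp (real m))" for m
  proof -
    have "fps_const (5 / 4 :: real) = 1 + fps_const (1 / 4)"
      unfolding fps_const_1_eq_1[symmetric] fps_const_add by simp
    then show ?thesis by (simp only:) (simp add: algebra_simps power2_eq_square power3_eq_cube)
  qed
  then have nth: "\<alpha> $ m = (fps_X * fps_exp (real m)
      - fps_const (5 / 4) * (fps_X\<^sup>2 * fps_exp (real m)) + fps_const (1 / 4) * (fps_X ^ 3 * fps_exp (real m))) $ m" for m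
    using lagrange_coefficient[of \<alpha> m] \<alpha> by metis
  have 0: "\<alpha> $ 0 = 0" and 1: "\<alpha> $ 1 = 1" and 2: "\<alpha> $ 2 = 3 / 4"
    unfolding nth by (simp_all add: fps_X_power_mult_nth)
  have 3: "\<alpha> $ (l + 3) = real (l + 3) ^ l * real (l + 4) / (2 * fact (l + 2))" for l
  proof -
    define x where "x = real (l + 3)"
    have l: "real l = x - 3" by (simp add: x_def)
    define F u v :: real where "F = fact l" and "u = real l + 1" and "v = real l + 2"
    have pos: "F \<noteq> 0" "u \<noteq> 0" "v \<noteq> 0" by (simp_all add: F_def u_def v_def)
    have fact: "fact (l + 1) = u * F" "fact (l + 2) = v * (u * F)"
      by (simp_all add: F_def u_def v_def numeral_2_eq_2 add_ac)
    have "\<alpha> $ (l + 3) = x ^ (l + 2) / fact (l + 2) - 5 / 4 * (x ^ (l + 1) / fact (l + 1)) + 1 / 4 * (x ^ l / fact l)"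
      unfolding nth x_def[symmetric] by (simp add: fps_X_power_mult_nth numeral_eq_Suc del: fact_Suc power_Suc)
    also have "\<dots> = x ^ l * (x\<^sup>2 - 5 / 4 * x * v + 1 / 4 * v * u) / fact (l + 2)"
      using pos unfolding fact F_def[symmetric] by (simp add: field_simps power2_eq_square power_add)
    also have "x\<^sup>2 - 5 / 4 * x * v + 1 / 4 * v * u = real (l + 4) / 2"
      unfolding of_nat_add u_def v_def l by (simp add: field_simps power2_eq_square)
    finally show ?thesis by (simp add: x_def)
  qed
  have "\<alpha> $ k \<le> \<alpha> $ Suc k" if "2 \<le> k" for k
  proof (cases "k = 2")
    case True
    then show ?thesis using 2 3[of 0] by (simp add: numeral_3_eq_3 numeral_2_eq_2)
  next
    case False
    with that obtain l where k: "k = l + 3" by (metis add.commute le_Suc_ex le_antisym not_less_eq_eq numeral_2_eq_2 numeral_3_eq_3)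
    have "real (l + 3) ^ (l + 1) * real (l + 4) \<le> real (l + 4) ^ (l + 1) * real (l + 5)"
      by (intro mult_mono power_mono) auto
    then have "real (l + 3) ^ l * real (l + 4) * real (l + 3) / (2 * fact (l + 3)) \<le> real (l + 4) ^ (l + 1) * real (l + 5) / (2 * fact (l + 3))"
      by (intro divide_right_mono) (auto simp: mult_ac)
    moreover have "real (l + 3) ^ l * real (l + 4) * real (l + 3) / (2 * fact (l + 3)) = \<alpha> $ k"
    proof -
      have "fact (l + 3) = real (l + 3) * fact (l + 2)"
        using fact_Suc[of "l + 2"] by (simp add: numeral_eq_Suc)
      then show ?thesis using 3[of l] k by simp
    qed
    moreover have "real (l + 4) ^ (l + 1) * real (l + 5) / (2 * fact (l + 3)) = \<alpha> $ Suc k"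
    proof -
      have "Suc k = (l + 1) + 3" "(l + 1) + 4 = l + 5" "(l + 1) + 2 = l + 3" "(l + 1) + 3 = l + 4" by (simp_all add: k)
      with 3[of "l + 1"] show ?thesis by (simp only:)
    qed
    ultimately show ?thesis by simp
  qed
  then show thesis by (rule that[OF \<alpha> 0 1 2])
qed

text \<open>Both factors are written as series in \<open>X exp(- X)\<close>. Because \<open>n = m - 1 + c\<close>, the factor \<open>exp(m X)\<close> contained in
\<open>exp(magic_log n)\<close> is exactly the one that Lagrange inversion consumes, so what is left depends on \<open>c\<close> only and the
coefficient becomes that of \<open>\<alpha>\<^sup>j b\<close>. For \<open>c > 0\<close> all coefficients of \<open>b\<close> are nonnegative. For \<open>c = 0\<close> the
coefficient of \<open>z\<close> is \<open>- 1\<close>, and \<open>b = 1 - z + P\<close> with nonnegative \<open>P\<close>.\<close>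

lemma sign_of_magic_coefficients:
  fixes c m n j :: nat
  assumes interior: "\<And>r. 2 \<le> r + c \<Longrightarrow> 0 \<le> fexp (magic_log (real r + real c - 1)) $ r"
    and n: "n + 1 = m + c"
  shows "m > 0 \<Longrightarrow> n > 0 \<Longrightarrow> (m, n) \<noteq> (2, 1) \<Longrightarrow> 0 \<le> (magic_base ^ j * fexp (magic_log n)) $ m"
    and "m = 2 \<Longrightarrow> n = 1 \<Longrightarrow> (magic_base * fexp (magic_log n)) $ m < 0"
proof -
  obtain \<alpha> where \<alpha>: "magic_base = \<alpha> oo tree_inverse" "\<alpha> $ 0 = 0" "\<alpha> $ 1 = 1" "\<alpha> $ 2 = 3 / 4"
    "\<And>k. 2 \<le> k \<Longrightarrow> \<alpha> $ k \<le> \<alpha> $ Suc k" by (rule magic_base_factor) blast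
  obtain b where b: "fexp (magic_log (real c - 1)) * inverse (1 - fps_X) = b oo tree_inverse"
    using tree_inverse_factor by blast
  have b_nth': "(b oo tree_inverse) * ((1 - fps_X) * fps_exp (real r)) = fexp (magic_log (real r + real c - 1))" for r
  proof -
    have "(1 - fps_X) * inverse (1 - fps_X :: real fps) = 1"
      by (simp add: inverse_mult_eq_1')
    then have "(b oo tree_inverse) * ((1 - fps_X) * fps_exp (real r)) = fexp (magic_log (real c - 1)) * fps_exp (real r)"
      unfolding b[symmetric] by algebra
    also have "\<dots> = fexp (magic_log (real c - 1) + fps_const (real r) * fps_X)"
      by (simp add: fps_exp_eq_fexp fexp_add)
    also have "magic_log (real c - 1) + fps_const (real r) * fps_X = magic_log (real r + real c - 1)"
      by (simp add: magic_log_def fps_eq_iff algebra_simps)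
    finally show ?thesis .
  qed
  have b_nth: "b $ r = fexp (magic_log (real r + real c - 1)) $ r" for r
    using lagrange_coefficient[of b r] b_nth' by metis
  have n': "real m + real c - 1 = real n"
    using n by (metis add_diff_cancel_right' of_nat_1 of_nat_add)
  have coeff: "(magic_base ^ i * fexp (magic_log n)) $ m = (\<alpha> ^ i * b) $ m" for i
  proof -
    have "magic_base ^ i * fexp (magic_log n) = ((\<alpha> ^ i * b) oo tree_inverse) * ((1 - fps_X) * fps_exp (real m))"
      using b_nth'[of m] by (simp add: \<alpha>(1) fps_compose_mult_distrib fps_compose_power n' mult.assoc)
    then show ?thesis using lagrange_coefficient by metis
  qed
  have \<alpha>_nonneg: "fps_nonneg \<alpha>"
  proof -
    have "0 \<le> \<alpha> $ k" for k
    proof (cases "k < 2")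
      case True
      then show ?thesis using \<alpha>(2,3) by (auto simp: numeral_2_eq_2 less_Suc_eq)
    next
      case False
      then have "2 \<le> k" by simp
      then show ?thesis
      proof (induction k rule: dec_induct)
        case (step k)
        then show ?case using \<alpha>(5)[of k] by simp
      qed (simp add: \<alpha>(4))
    qed
    then show ?thesis by (simp add: fps_nonneg_def)
  qed
  have b0: "b $ 0 = 1" by (simp add: b_nth)
  have b1: "b $ 1 = -1" if "c = 0"
  proof -
    have "fexp (magic_log 0) $ 1 = fps_deriv (fexp (magic_log 0)) $ 0" by simp
    also have "\<dots> = -1"
      by (subst fexp_deriv) (simp_all add: magic_log_def logser_def)
    finally show ?thesis using that by (simp add: b_nth)
  qed
  have b_nonneg: "0 \<le> b $ r" if "2 \<le> r + c" for r
    using interior[OF that] by (simp add: b_nth)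
  define D where "D = \<alpha> * (1 - fps_X)"
  have D_Suc: "D $ Suc k = \<alpha> $ Suc k - \<alpha> $ k" for k
    by (simp add: D_def algebra_simps)
  have D0: "D $ 0 = 0" by (simp add: D_def \<alpha>)
  have D: "D $ k \<ge> 0" if k2: "k \<noteq> 2" for k
  proof -
    consider "k = 0" | "k = 1" | "2 \<le> k - 1"
      using k2 by linarith
    then show ?thesis
    proof cases
      case 2
      then show ?thesis using D_Suc[of 0] \<alpha>(2,3) by simp
    next
      case 3
      then show ?thesis using D_Suc[of "k - 1"] \<alpha>(5)[of "k - 1"] by simp
    qed (simp add: D0)
  qed
  define P where "P = b - 1 + fps_X"
  have P: "fps_nonneg P" if "c = 0"
  proof -
    have "0 \<le> P $ k" for k
    proof (cases "k < 2")
      case True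
      then show ?thesis using b0 b1[OF that] by (auto simp: P_def numeral_2_eq_2 less_Suc_eq)
    next
      case False
      then show ?thesis using b_nonneg[of k] by (simp add: P_def fps_X_nth)
    qed
    then show ?thesis by (simp add: fps_nonneg_def)
  qed
  have split: "\<alpha> ^ Suc i * b = \<alpha> ^ i * D + \<alpha> ^ Suc i * P" for i
    by (simp add: D_def P_def algebra_simps)
  show "0 \<le> (magic_base ^ j * fexp (magic_log n)) $ m" if pos: "m > 0" "n > 0" "(m, n) \<noteq> (2, 1)"
  proof (cases "c = 0")
    case False
    have "0 \<le> b $ r" for r
      using b_nonneg[of r] b0 False by (cases r) auto
    then have "fps_nonneg (\<alpha> ^ j * b)"
      using \<alpha>_nonneg fps_nonneg_mult fps_nonneg_power by (auto simp: fps_nonneg_def)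
    then show ?thesis by (simp add: coeff fps_nonneg_def)
  next
    case True
    then have m: "m \<ge> 3" using pos n by auto
    consider "j = 0" | "j = 1" | i where "j = Suc (Suc i)"
      using less_2_cases[of j] le_Suc_ex[of 2 j] by (force simp: not_less)
    then have "0 \<le> (\<alpha> ^ j * b) $ m"
    proof cases
      case 1
      then show ?thesis using b_nonneg[of m] m by simp
    next
      case 2
      have "fps_nonneg (\<alpha> * P)" using \<alpha>_nonneg P[OF True] fps_nonneg_mult by blast
      then show ?thesis using 2 split[of 0] D[of m] m by (simp add: fps_nonneg_def)
    next
      case 3
      \<comment> \<open>\<open>D = \<alpha> (1 - z)\<close> starts with \<open>z - z\<^sup>2 / 4\<close> and is nonnegative afterwards; multiplied by \<open>\<alpha>\<close>, the negative
        term is absorbed since a coefficient of \<open>\<alpha>\<close> is never less than a quarter of the previous one.\<close>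
      have "0 \<le> (\<alpha> * D) $ k" for k
      proof -
        define R where "R = D - (fps_X - fps_const (1 / 4) * fps_X\<^sup>2)"
        have "0 \<le> R $ k" for k
        proof -
          consider "k = 1" | "k = 2" | "k \<noteq> 1" "k \<noteq> 2" by blast
          then show ?thesis
          proof cases
            case 1
            then show ?thesis using D_Suc[of 0] \<alpha>(2,3) by (simp add: R_def)
          next
            case 2
            have "D $ 2 = -1 / 4" using D_Suc[of 1] \<alpha>(3,4) by (simp add: numeral_2_eq_2)
            then show ?thesis using 2 by (simp add: R_def)
          next
            case 3
            then show ?thesis using D[of k] by (simp add: R_def fps_X_nth fps_X_power_nth)
          qed
        qed
        then have "fps_nonneg (\<alpha> * R)"
          using \<alpha>_nonneg fps_nonneg_mult by (auto simp: fps_nonneg_def)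
        moreover have "0 \<le> (\<alpha> * (fps_X - fps_const (1 / 4) * fps_X\<^sup>2)) $ k"
        proof -
          have eq: "\<alpha> * (fps_X - fps_const (1 / 4) * fps_X\<^sup>2) = fps_X * \<alpha> - fps_const (1 / 4) * (fps_X\<^sup>2 * \<alpha>)"
            by (simp add: algebra_simps)
          consider "k = 0" | "k = 1" | "k = 2" | "k = 3" | l where "k = Suc (Suc l)" "2 \<le> l"
            using le_Suc_ex[of 4 k] by (cases "k < 4") (auto simp: less_Suc_eq numeral_eq_Suc)
          then show ?thesis
          proof cases
            case (5 l)
            moreover have "0 \<le> \<alpha> $ l" using \<alpha>_nonneg by (simp add: fps_nonneg_def)
            ultimately show ?thesis using \<alpha>(5)[of l]
              unfolding eq by (simp add: fps_X_power_mult_nth fps_nonneg_def)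
          qed (use \<alpha>(2-4) in \<open>simp_all add: eq fps_X_power_mult_nth\<close>)
        qed
        moreover have "\<alpha> * D = \<alpha> * R + \<alpha> * (fps_X - fps_const (1 / 4) * fps_X\<^sup>2)"
          by (simp add: R_def algebra_simps)
        ultimately show ?thesis by (simp add: fps_nonneg_def)
      qed
      then have "fps_nonneg (\<alpha> ^ i * (\<alpha> * D))"
        using \<alpha>_nonneg fps_nonneg_mult fps_nonneg_power by (auto simp: fps_nonneg_def)
      moreover have "fps_nonneg (\<alpha> ^ j * P)"
        using \<alpha>_nonneg fps_nonneg_mult fps_nonneg_power P[OF True] by blast
      moreover have "\<alpha> ^ j * b = \<alpha> ^ i * (\<alpha> * D) + \<alpha> ^ j * P"
        using split[of "Suc i"] 3 by (simp add: mult_ac)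
      ultimately show ?thesis by (simp add: fps_nonneg_def)
    qed
    then show ?thesis by (simp add: coeff)
  qed
  show "(magic_base * fexp (magic_log n)) $ m < 0" if "m = 2" "n = 1"
  proof -
    have c: "c = 0" using that n by simp
    have "(\<alpha> * b) $ 2 = -1 / 4"
      using \<alpha>(2-4) b0 b1[OF c] by (simp add: fps_mult_nth numeral_2_eq_2)
    then show ?thesis using coeff[of 1] that by simp
  qed
qed

section \<open>The Ehrhart polynomial in the magic basis\<close>

lemma fps_exp_cancel:
  fixes f f' :: "real fps" and t :: nat
  assumes "\<And>N m. t * m \<le> N \<Longrightarrow> (f * fps_exp (real N)) $ m = (f' * fps_exp (real N)) $ m"
  shows "f = f'"
proof -
  have "f $ m = f' $ m" for m
  proof -
    have nth: "q $ m = (\<Sum>i=0..m. (q * fps_exp (real (t * m))) $ i * fps_exp (- real (t * m)) $ (m - i))" for q :: "real fps"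
    proof -
      have "fps_exp (real (t * m)) * fps_exp (- real (t * m)) = 1"
        unfolding fps_exp_add_mult[symmetric] by simp
      then have "q = (q * fps_exp (real (t * m))) * fps_exp (- real (t * m))"
        by (simp add: mult.assoc)
      then show ?thesis by (metis fps_mult_nth)
    qed
    show ?thesis
      unfolding nth[of f] nth[of f']
    proof (rule sum.cong[OF refl])
      fix i assume "i \<in> {0..m}"
      then have "t * i \<le> t * m" by simp
      then show "(f * fps_exp (real (t * m))) $ i * fps_exp (- real (t * m)) $ (m - i)
          = (f' * fps_exp (real (t * m))) $ i * fps_exp (- real (t * m)) $ (m - i)"
        by (simp only: assms)
    qed
  qed
  then show ?thesis by (simp add: fps_eq_iff)
qed

text \<open>The three statistics \<open>1\<close>, \<open>|T(y)|\<close> and \<open>t (|T(y)| choose 2)\<close> of the largest tight set become, in terms of generating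
functions, the hypotheses of \<open>tight_set_system_solution\<close>. The identities hold for \<open>N \<ge> t m\<close> only, which suffices to
compare coefficients.\<close>

lemma num_scores_exponential_formula:
  fixes t N m :: nat
  assumes N: "t * (m - 1) \<le> N + 1"
  shows "real (num_scores t 0 N m) = fact m * fexp (fps_const (real N + 1 + real t / 2) * fps_X
      - fps_const (real t / 4) * fps_X\<^sup>2 - fps_const (1 / 2) * (logser oo (fps_const (real t) * fps_X))) $ m"
    and "real (num_scores t 1 N m) = fact m * fexp (fps_const (real N + real t / 2) * fps_X
      + fps_const (real t / 4) * fps_X\<^sup>2 - fps_const (1 / 2) * (logser oo (fps_const (real t) * fps_X))) $ m"
proof -
  have step: "real (num_scores t e (N + 1) m) = (\<Sum>k\<le>m. real (m choose k) * real (num_scores t e N (m - k)))"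
    if "t * (m - 1) \<le> N + 1" "e \<le> 1" for e N m
    using num_scores_Suc[OF that] by simp
  obtain c where c: "\<And>N m. t * (m - 1) \<le> N + 1 \<Longrightarrow> real (num_scores t 0 N m) = fact m * (fps_exp (real N) * c) $ m"
    using appell_sequence_egf[of t "\<lambda>N m. real (num_scores t 0 N m)"] step[of _ _ 0] by auto
  obtain g where g: "\<And>N m. t * (m - 1) \<le> N + 1 \<Longrightarrow> real (num_scores t 1 N m) = fact m * (fps_exp (real N) * g) $ m"
    using appell_sequence_egf[of t "\<lambda>N m. real (num_scores t 1 N m)"] step[of _ _ 1] by auto
  define h where "h = Abs_fps (\<lambda>k. real (num_tight_scores t k) / fact k)"
  define \<zeta> where "\<zeta> = fps_X * fps_exp (- real t)"
  have \<zeta>0: "\<zeta> $ 0 = 0" by (simp add: \<zeta>_def)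
  \<comment> \<open>A statistic \<open>F(|T(y)|)\<close> multiplies the coefficients of \<open>h\<close> by \<open>F\<close>; the shift of the bound from \<open>N\<close> to \<open>N - t k\<close>
    turns \<open>X\<^sup>k\<close> into \<open>\<zeta>\<^sup>k\<close>.\<close>
  have moment: "((Abs_fps (\<lambda>k. real (F k) * h $ k) oo \<zeta>) * g * fps_exp (real N)) $ m
      = real (\<Sum>y\<in>score_vectors t 0 N {..<m}. F (card (max_tight t {..<m} y))) / fact m"
    if N: "t * m \<le> N" for F :: "nat \<Rightarrow> nat" and N m
  proof -
    have "(\<zeta> ^ k * (g * fps_exp (real N))) $ m = real (num_scores t 1 (N - t * k) (m - k)) / fact (m - k)"
      if k: "k \<le> m" for k
    proof -
      have tk: "t * k \<le> N" using N k by (meson le_trans mult_le_mono2)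
      have "\<zeta> ^ k * (g * fps_exp (real N)) = fps_X ^ k * (fps_exp (- real (t * k)) * fps_exp (real N) * g)"
        by (simp add: \<zeta>_def power_mult_distrib fps_exp_power_mult mult_ac)
      also have "fps_exp (- real (t * k)) * fps_exp (real N) = fps_exp (real (N - t * k))"
        using tk unfolding fps_exp_add_mult[symmetric] by (simp add: of_nat_diff)
      finally have "(\<zeta> ^ k * (g * fps_exp (real N))) $ m = (fps_X ^ k * (fps_exp (real (N - t * k)) * g)) $ m"
        by (rule arg_cong)
      also have "\<dots> = (fps_exp (real (N - t * k)) * g) $ (m - k)"
        using k by (simp only: fps_X_power_mult_nth if_False not_less[symmetric])
      also have "\<dots> = real (num_scores t 1 (N - t * k) (m - k)) / fact (m - k)"
      proof -
        have "t * (m - k - 1) + t * k \<le> N + 1"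
        proof (cases "k < m")
          case True
          then have "m - k - 1 + k \<le> m" by simp
          then have "t * (m - k - 1 + k) \<le> t * m" by (rule mult_le_mono2)
          then show ?thesis using N by (simp add: distrib_left)
        next
          case False
          then show ?thesis using tk by simp
        qed
        then have "t * (m - k - 1) \<le> N - t * k + 1" by linarith
        then show ?thesis using g[of "m - k" "N - t * k"] by simp
      qed
      finally show ?thesis .
    qed
    then have "((Abs_fps (\<lambda>k. real (F k) * h $ k) oo \<zeta>) * (g * fps_exp (real N))) $ m
        = (\<Sum>k\<le>m. real (F k) * h $ k * (real (num_scores t 1 (N - t * k) (m - k)) / fact (m - k)))"
      unfolding fps_compose_mult_nth[OF \<zeta>0] by (intro sum.cong) auto
    also have "\<dots> = (\<Sum>k\<le>m. real ((m choose k) * (F k * (num_tight_scores t k * num_scores t 1 (N - t * k) (m - k))))) / fact m"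
      unfolding sum_divide_distrib by (intro sum.cong) (auto simp: h_def binomial_fact)
    also have "\<dots> = real (\<Sum>y\<in>score_vectors t 0 N {..<m}. F (card (max_tight t {..<m} y))) / fact m"
      using sum_over_max_tight[of "{..<m}" t N F] N by simp
    finally show ?thesis by (simp add: mult.assoc)
  qed
  have c_nth: "(c * fps_exp (real N)) $ m = real (num_scores t 0 N m) / fact m" if "t * m \<le> N" for N m
  proof -
    have "t * (m - 1) \<le> N + 1"
      using that mult_le_mono2[of "m - 1" m t] by linarith
    from c[OF this] show ?thesis by (simp add: mult.commute)
  qed
  have total: "c = (h oo \<zeta>) * g"
  proof (rule fps_exp_cancel[of t])
    fix N m assume N: "t * m \<le> N"
    have "Abs_fps (\<lambda>k. real 1 * h $ k) = h" by (simp add: fps_eq_iff)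
    then show "(c * fps_exp (real N)) $ m = ((h oo \<zeta>) * g * fps_exp (real N)) $ m"
      using moment[OF N, of "\<lambda>_. 1"] c_nth[OF N] by (simp add: num_scores_def)
  qed
  have size: "((fps_X * fps_deriv h) oo \<zeta>) * g = fps_X * c"
  proof (rule fps_exp_cancel[of t])
    fix N m assume N: "t * m \<le> N"
    have "Abs_fps (\<lambda>k. real k * h $ k) = fps_X * fps_deriv h"
      by (simp add: fps_eq_iff)
    then have "((fps_X * fps_deriv h oo \<zeta>) * g * fps_exp (real N)) $ m
        = real m * real (num_scores t 0 N (m - 1)) / fact m"
      using moment[OF N, of "\<lambda>k. k"] max_tight_moments(1)[OF N, of "{..<m}"] by simp
    also have "\<dots> = (fps_X * (c * fps_exp (real N))) $ m"
    proof (cases m)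
      case (Suc k)
      then have "t * k \<le> N" using N by simp
      then show ?thesis using c_nth[of k N] Suc by (simp add: divide_simps)
    qed simp
    finally show "((fps_X * fps_deriv h oo \<zeta>) * g * fps_exp (real N)) $ m = (fps_X * c * fps_exp (real N)) $ m"
      by (simp add: mult.assoc)
  qed
  have sum: "fps_const (real t / 2) * ((fps_X\<^sup>2 * fps_deriv (fps_deriv h)) oo \<zeta>) * g = fps_X * (c - fps_deriv c)"
  proof (rule fps_exp_cancel[of t])
    fix N m assume N: "t * m \<le> N"
    have "Abs_fps (\<lambda>k. real (t * (k choose 2)) * h $ k) = fps_const (real t / 2) * (fps_X\<^sup>2 * fps_deriv (fps_deriv h))"
    proof -
      have "real (t * (k choose 2)) * h $ k = (fps_const (real t / 2) * (fps_X\<^sup>2 * fps_deriv (fps_deriv h))) $ k" for k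
      proof (cases "k < 2")
        case True
        then have "(k choose 2) = 0" by (rule binomial_eq_0)
        then show ?thesis using True by (simp add: fps_X_power_mult_nth)
      next
        case False
        then obtain l where k: "k = l + 2" by (metis add.commute le_Suc_ex not_less)
        have "2 * real (k choose 2) = real k * real (k - 1)"
          unfolding of_nat_mult[symmetric] choose_two_double[symmetric] by simp
        then have "real (k choose 2) = real k * real (k - 1) / 2" by simp
        then show ?thesis by (simp add: fps_X_power_mult_nth k)
      qed
      then show ?thesis by (simp add: fps_eq_iff)
    qed
    then have "((fps_const (real t / 2) * (fps_X\<^sup>2 * fps_deriv (fps_deriv h)) oo \<zeta>) * g * fps_exp (real N)) $ m
        = real (\<Sum>y\<in>score_vectors t 0 N {..<m}. t * (card (max_tight t {..<m} y) choose 2)) / fact m"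
      using moment[OF N, of "\<lambda>k. t * (k choose 2)"] by simp
    moreover have "fps_const (real t / 2) * (fps_X\<^sup>2 * fps_deriv (fps_deriv h)) oo \<zeta>
        = fps_const (real t / 2) * (fps_X\<^sup>2 * fps_deriv (fps_deriv h) oo \<zeta>)"
      by (simp only: fps_compose_mult_distrib[OF \<zeta>0, of "fps_const (real t / 2)"] fps_const_compose)
    ultimately have lhs: "(fps_const (real t / 2) * (fps_X\<^sup>2 * fps_deriv (fps_deriv h) oo \<zeta>) * g * fps_exp (real N)) $ m
        = real (\<Sum>y\<in>score_vectors t 0 N {..<m}. t * (card (max_tight t {..<m} y) choose 2)) / fact m" by simp
    have "real (\<Sum>y\<in>score_vectors t 0 N {..<m}. t * (card (max_tight t {..<m} y) choose 2))
        = real m * ((real N + 1) * real (num_scores t 0 N (m - 1))) - real m * real (num_scores t 0 N m)"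
      using arg_cong[OF max_tight_moments(2)[OF N, of "{..<m}"], of real] by (simp add: algebra_simps)
    also have "\<dots> / fact m = (fps_const (real N + 1) * (fps_X * (c * fps_exp (real N)))
        - fps_X * fps_deriv (c * fps_exp (real N))) $ m"
    proof (cases m)
      case (Suc k)
      then have k: "t * k \<le> N" using N by simp
      have "real m * ((real N + 1) * real (num_scores t 0 N (m - 1))) / fact m
          = (real N + 1) * (c * fps_exp (real N)) $ k"
        unfolding c_nth[OF k] using Suc by (simp add: divide_simps)
      moreover have "real m * real (num_scores t 0 N m) / fact m = real m * (c * fps_exp (real N)) $ m"
        by (simp add: c_nth[OF N])
      ultimately show ?thesis using Suc by (simp add: diff_divide_distrib del: fps_deriv_mult)
    qed simp
    also have "fps_const (real N + 1) * (fps_X * (c * fps_exp (real N))) - fps_X * fps_deriv (c * fps_exp (real N))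
        = fps_X * (c - fps_deriv c) * fps_exp (real N)"
      by (simp add: algebra_simps flip: fps_const_add)
    finally show "(fps_const (real t / 2) * (fps_X\<^sup>2 * fps_deriv (fps_deriv h) oo \<zeta>) * g * fps_exp (real N)) $ m
        = (fps_X * (c - fps_deriv c) * fps_exp (real N)) $ m"
      unfolding lhs .
  qed
  have g0: "g $ 0 = 1" using g[of 0 0] by simp
  have h0: "h $ 0 = 1" by (simp add: h_def)
  note solution = tight_set_system_solution[OF total[unfolded \<zeta>_def] size[unfolded \<zeta>_def] sum[unfolded \<zeta>_def] g0 h0]
  let ?L = "fps_const (1 / 2) * (logser oo (fps_const (real t) * fps_X))"
  have "fps_exp (real N) * c = fexp (fps_const (real N) * fps_X
      + (fps_const (1 + real t / 2) * fps_X - fps_const (real t / 4) * fps_X\<^sup>2 - ?L))"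
    unfolding solution(1) fps_exp_eq_fexp by (rule fexp_add[symmetric]) simp_all
  also have "fps_const (real N) * fps_X
      + (fps_const (1 + real t / 2) * fps_X - fps_const (real t / 4) * fps_X\<^sup>2 - ?L)
      = fps_const (real N + 1 + real t / 2) * fps_X - fps_const (real t / 4) * fps_X\<^sup>2 - ?L"
    by (simp add: algebra_simps flip: fps_const_add)
  finally show "real (num_scores t 0 N m) = fact m * fexp (fps_const (real N + 1 + real t / 2) * fps_X
      - fps_const (real t / 4) * fps_X\<^sup>2 - ?L) $ m"
    using c[OF N] by simp
  have "fps_exp (real N) * g = fexp (fps_const (real N) * fps_X
      + (fps_const (real t / 2) * fps_X + fps_const (real t / 4) * fps_X\<^sup>2 - ?L))"
    unfolding solution(2) fps_exp_eq_fexp by (rule fexp_add[symmetric]) simp_all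
  also have "fps_const (real N) * fps_X
      + (fps_const (real t / 2) * fps_X + fps_const (real t / 4) * fps_X\<^sup>2 - ?L)
      = fps_const (real N + real t / 2) * fps_X + fps_const (real t / 4) * fps_X\<^sup>2 - ?L"
    by (simp add: algebra_simps flip: fps_const_add)
  finally show "real (num_scores t 1 N m) = fact m * fexp (fps_const (real N + real t / 2) * fps_X
      + fps_const (real t / 4) * fps_X\<^sup>2 - ?L) $ m"
    using g[OF N] by simp
qed

definition magic_coeff :: "nat \<Rightarrow> nat \<Rightarrow> nat \<Rightarrow> real" where
  "magic_coeff m n i = fact m / fact (m - i) * (magic_base ^ (m - i) * fexp (magic_log (real n))) $ m"

lemma num_scores_magic_expansion:
  assumes "m \<le> n + 1" "t > 0"
  shows "real (num_scores t 0 (t * n) m) = (\<Sum>i\<le>m. magic_coeff m n i * (real t ^ i * (real t + 1) ^ (m - i)))"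
proof -
  have "t * (m - 1) \<le> t * n" using assms by (intro mult_le_mono2) simp
  then have "t * (m - 1) \<le> t * n + 1" by (rule le_trans) simp
  from num_scores_exponential_formula(1)[OF this]
  have "real (num_scores t 0 (t * n) m) = fact m * fexp (fps_const (real t * real n + 1 + real t / 2) * fps_X
      - fps_const (real t / 4) * fps_X\<^sup>2 - fps_const (1 / 2) * (logser oo (fps_const (real t) * fps_X))) $ m"
    by simp
  also have "\<dots> = (\<Sum>j\<le>m. fact m * ((magic_base ^ j * fexp (magic_log n)) $ m / fact j * (real t ^ (m - j) * (real t + 1) ^ j)))"
    using assms by (subst magic_expansion) (simp_all add: sum_distrib_left)
  also have "\<dots> = (\<Sum>i\<le>m. magic_coeff m n i * (real t ^ i * (real t + 1) ^ (m - i)))"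
    by (rule sum.reindex_bij_witness[of _ "\<lambda>i. m - i" "\<lambda>i. m - i"]) (auto simp: magic_coeff_def)
  finally show ?thesis .
qed

text \<open>Up to the factor \<open>r!\<close> this number is a count: score vectors with \<open>t = 1\<close>, strict inequalities and the bound
\<open>n - 1\<close> for \<open>n = r + c - 1\<close>, which correspond to the interior lattice points of \<open>P(r, n)\<close>.\<close>

lemma interior_coefficient_nonneg:
  assumes "2 \<le> r + c"
  shows "0 \<le> fexp (magic_log (real r + real c - 1)) $ r"
proof -
  define N where "N = r + c - 2"
  have N: "1 * (r - 1) \<le> N + 1" using assms by (simp add: N_def)
  have "magic_log (real r + real c - 1) = fps_const (real N + real 1 / 2) * fps_X
      + fps_const (real 1 / 4) * fps_X\<^sup>2 - fps_const (1 / 2) * (logser oo (fps_const (real 1) * fps_X))"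
    using assms by (simp add: magic_log_def N_def of_nat_diff)
  then have "fact r * fexp (magic_log (real r + real c - 1)) $ r = real (num_scores 1 1 N r)"
    using num_scores_exponential_formula(2)[OF N] by simp
  then show ?thesis by (metis fact_gt_zero of_nat_0_le_iff zero_le_mult_iff not_less)
qed

lemma magic_coeff_nonneg:
  assumes "m > 0" "n > 0" "m \<le> n + 1" "(m, n) \<noteq> (2, 1)"
  shows "0 \<le> magic_coeff m n i"
proof -
  have "n + 1 = m + (n + 1 - m)" using assms(3) by simp
  from sign_of_magic_coefficients(1)[OF interior_coefficient_nonneg this assms(1,2,4)]
  show ?thesis by (simp add: magic_coeff_def)
qed

lemma magic_coeff_2_1_neg: "magic_coeff 2 1 1 < 0"
proof -
  have "1 + 1 = 2 + (0 :: nat)" by simp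
  from sign_of_magic_coefficients(2)[OF interior_coefficient_nonneg this refl refl]
  show ?thesis by (simp add: magic_coeff_def)
qed

unbundle no fps_syntax
unbundle vec_syntax

section \<open>The partial permutohedron as a polymatroid\<close>

lemma choose_two_le_sum:
  "finite C \<Longrightarrow> (card C choose 2) \<le> \<Sum>C" for C :: "nat set"
proof (induction C rule: finite_linorder_max_induct)
  case (insert b C)
  have "card C \<le> b"
    using insert(2) card_mono[of "{..<b}" C] by auto
  moreover have "b \<notin> C" using insert(2) by auto
  ultimately show ?case using insert by (simp add: numeral_2_eq_2)
qed (simp add: numeral_2_eq_2)

abbreviation top_sum :: "nat \<Rightarrow> nat \<Rightarrow> real" where
  "top_sum n k \<equiv> \<Sum>i<k. real n - real i"

lemma top_sum_eq: "top_sum n k = real k * real n - real (k choose 2)"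
  by (induction k) (simp_all add: numeral_2_eq_2 algebra_simps)

lemma top_sum_mono:
  assumes "j \<le> k" "k \<le> n + 1"
  shows "top_sum n j \<le> top_sum n k"
  using assms by (intro sum_mono2) auto

definition partial_permutations :: "nat \<Rightarrow> (real ^ 'm) set" where
  "partial_permutations n = {x. (\<forall>i. x $ i \<in> real ` {0..n}) \<and>
         (\<forall>i j. i \<noteq> j \<and> x $ i \<noteq> 0 \<and> x $ j \<noteq> 0 \<longrightarrow> x $ i \<noteq> x $ j)}"

lemma partial_permutohedron_hull:
  "partial_permutohedron n = convex hull partial_permutations n"
  by (simp add: partial_permutohedron_def partial_permutations_def)

lemma finite_partial_permutations: "finite (partial_permutations n :: (real ^ 'm::finite) set)"
proof (rule finite_subset)
  show "(partial_permutations n :: (real ^ 'm) set) \<subseteq> vec_lambda ` (UNIV \<rightarrow>\<^sub>E real ` {0..n})"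
  proof
    fix x :: "real ^ 'm" assume "x \<in> partial_permutations n"
    then show "x \<in> vec_lambda ` (UNIV \<rightarrow>\<^sub>E real ` {0..n})"
      by (intro image_eqI[of _ _ "vec_nth x"]) (auto simp: partial_permutations_def)
  qed
  show "finite (vec_lambda ` (UNIV \<rightarrow>\<^sub>E real ` {0..n}) :: (real ^ 'm) set)"
    by (intro finite_imageI finite_PiE) simp_all
qed

text \<open>The nonzero entries in \<open>S\<close> are distinct numbers below \<open>n + 1\<close>, so their sum is at most that of the largest
admissible numbers. Zero entries are harmless because \<open>n \<ge> m - 1\<close> makes all summands of \<open>top_sum\<close> nonnegative.\<close>

lemma partial_permutation_sum_le:
  fixes x :: "real ^ 'm::finite"
  assumes x: "x \<in> partial_permutations n" and n: "CARD('m) \<le> n + 1"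
  shows "(\<Sum>i\<in>S. x $ i) \<le> top_sum n (card S)"
proof -
  define S' where "S' = {i \<in> S. x $ i \<noteq> 0}"
  have entries: "x $ i \<in> real ` {0..n}" for i using x by (simp add: partial_permutations_def)
  have distinct: "x $ i \<noteq> x $ j" if "i \<noteq> j" "x $ i \<noteq> 0" "x $ j \<noteq> 0" for i j
    using x that by (simp add: partial_permutations_def)
  have "\<forall>i. \<exists>k. x $ i = real k \<and> k \<le> n" using entries by fastforce
  then obtain a where a: "\<And>i. x $ i = real (a i)" "\<And>i. a i \<le> n" by metis
  have inj: "inj_on (\<lambda>i. n - a i) S'"
  proof (rule inj_onI)
    fix i j assume ij: "i \<in> S'" "j \<in> S'" "n - a i = n - a j"
    then have "a i = a j" using a(2) by (metis diff_diff_cancel)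
    then have "x $ i = x $ j" by (simp add: a(1))
    then show "i = j" using ij(1,2) distinct[of i j] by (auto simp: S'_def)
  qed
  have "(card S' choose 2) \<le> \<Sum>((\<lambda>i. n - a i) ` S')"
    using choose_two_le_sum[of "(\<lambda>i. n - a i) ` S'"] card_image[OF inj] by simp
  also have "\<dots> = (\<Sum>i\<in>S'. n - a i)" using inj by (simp add: sum.reindex)
  finally have "real (card S' choose 2) \<le> real (\<Sum>i\<in>S'. n - a i)" by (rule of_nat_mono)
  also have "\<dots> = (\<Sum>i\<in>S'. real n - real (a i))"
    using a(2) by (simp add: of_nat_diff)
  finally have "(\<Sum>i\<in>S'. x $ i) \<le> top_sum n (card S')"
    unfolding top_sum_eq by (simp add: a(1) sum_subtractf)
  also have "\<dots> \<le> top_sum n (card S)"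
  proof (rule top_sum_mono)
    show "card S' \<le> card S" by (intro card_mono) (auto simp: S'_def)
    have "card S \<le> CARD('m)" by (intro card_mono) auto
    then show "card S \<le> n + 1" using n by simp
  qed
  finally have "(\<Sum>i\<in>S'. x $ i) \<le> top_sum n (card S)" .
  moreover have "(\<Sum>i\<in>S. x $ i) = (\<Sum>i\<in>S'. x $ i)"
    by (intro sum.mono_neutral_right) (auto simp: S'_def)
  ultimately show ?thesis by simp
qed

text \<open>Abel summation: for decreasing weights the weighted partial sum up to \<open>k\<close> dominates the last weight times the
unweighted one.\<close>

lemma weighted_sum_nonneg_of_partial_sums:
  fixes a d :: "nat \<Rightarrow> real"
  assumes "\<And>i. i < p \<Longrightarrow> 0 \<le> a i" "\<And>i. Suc i < p \<Longrightarrow> a (Suc i) \<le> a i"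
    and "\<And>k. k \<le> p \<Longrightarrow> 0 \<le> (\<Sum>i<k. d i)"
  shows "0 \<le> (\<Sum>i<p. a i * d i)"
proof -
  have "a (k - 1) * (\<Sum>i<k. d i) \<le> (\<Sum>i<k. a i * d i)" if "k \<le> p" for k
    using that
  proof (induction k)
    case (Suc k)
    have "a k * (\<Sum>i<k. d i) \<le> a (k - 1) * (\<Sum>i<k. d i)"
    proof (cases k)
      case (Suc l)
      then show ?thesis using assms(2)[of l] assms(3)[of k] Suc.prems by (intro mult_right_mono) auto
    qed simp
    then show ?case using Suc by (simp add: algebra_simps)
  qed simp
  then have "a (p - 1) * (\<Sum>i<p. d i) \<le> (\<Sum>i<p. a i * d i)" by blast
  moreover have "0 \<le> a (p - 1) * (\<Sum>i<p. d i)"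
    using assms(1)[of "p - 1"] assms(3)[of p] by (cases p) auto
  ultimately show ?thesis by linarith
qed

text \<open>The greedy algorithm maximizes a linear functional over a polymatroid. Order the coordinates by decreasing weight,
give them the values \<open>n, n - 1, \<dots>\<close> and put \<open>0\<close> wherever the weight is not positive; Abel summation compares the
result with \<open>z\<close>.\<close>

lemma greedy_partial_permutation:
  fixes w z :: "real ^ 'm::finite"
  assumes z: "\<And>i. 0 \<le> z $ i" "\<And>S. (\<Sum>i\<in>S. z $ i) \<le> top_sum n (card S)"
    and n: "CARD('m) \<le> n + 1"
  obtains v where "v \<in> partial_permutations n" "w \<bullet> z \<le> w \<bullet> v"
proof -
  obtain ys where ys: "set ys = (UNIV :: 'm set)" "distinct ys"
    using finite_distinct_list[of "UNIV :: 'm set"] by auto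
  define xs where "xs = sort_key (\<lambda>i. - w $ i) ys"
  define m where "m = CARD('m)"
  have xs: "set xs = UNIV" "distinct xs" "sorted (map (\<lambda>i. - w $ i) xs)"
    using ys by (simp_all add: xs_def)
  have len: "length xs = m" using distinct_card[OF xs(2)] xs(1) by (simp add: m_def)
  define e where "e = (!) xs"
  have e: "bij_betw e {..<m} UNIV"
    using bij_betw_nth[OF xs(2), of "{..<m}" UNIV] xs(1) len by (simp add: e_def)
  have inj: "inj_on e {..<m}" using e by (simp add: bij_betw_def)
  have dec: "w $ e (Suc i) \<le> w $ e i" if "Suc i < m" for i
    using sorted_nth_mono[OF xs(3), of i "Suc i"] that len by (simp add: e_def)
  define f where "f = inv_into {..<m} e"
  have fe: "f (e i) = i" if "i < m" for i
    using inj that by (simp add: f_def)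
  define v :: "real ^ 'm" where "v = (\<chi> i. if w $ i > 0 then real (n - f i) else 0)"
  have f_lt: "f i < m" for i
    using e by (metis UNIV_I bij_betw_def f_def inv_into_into lessThan_iff)
  have "v \<in> partial_permutations n"
    unfolding partial_permutations_def
  proof (intro CollectI conjI allI impI)
    show "v $ i \<in> real ` {0..n}" for i by (auto simp: v_def)
    fix i j :: 'm assume ij: "i \<noteq> j \<and> v $ i \<noteq> 0 \<and> v $ j \<noteq> 0"
    have "f i \<noteq> f j"
      using ij e unfolding f_def by (metis UNIV_I bij_betw_def f_inv_into_f)
    moreover have "f i \<le> n" "f j \<le> n" using f_lt[of i] f_lt[of j] n by (auto simp: m_def)
    ultimately show "v $ i \<noteq> v $ j" using ij by (auto simp: v_def split: if_splits)
  qed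
  moreover have "w \<bullet> z \<le> w \<bullet> v"
  proof -
    define a where "a i = max 0 (w $ e i)" for i
    define d where "d i = (real n - real i) - z $ e i" for i
    have "0 \<le> (\<Sum>i<m. a i * d i)"
    proof (rule weighted_sum_nonneg_of_partial_sums)
      show "a (Suc i) \<le> a i" if "Suc i < m" for i using dec[OF that] by (simp add: a_def)
      fix k assume k: "k \<le> m"
      have injk: "inj_on e {..<k}" using inj k by (meson inj_on_subset lessThan_subset_iff)
      have "(\<Sum>i<k. z $ e i) = (\<Sum>i\<in>e ` {..<k}. z $ i)" using injk by (simp add: sum.reindex)
      also have "\<dots> \<le> top_sum n k" using z(2)[of "e ` {..<k}"] card_image[OF injk] by simp
      finally show "0 \<le> (\<Sum>i<k. d i)" by (simp add: d_def sum_subtractf)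
    qed (simp add: a_def)
    moreover have "a i * (real n - real i) = w $ e i * v $ e i" if "i < m" for i
    proof -
      have "real (n - i) = real n - real i" using that n by (intro of_nat_diff) (simp add: m_def)
      then show ?thesis using fe[OF that] by (simp add: a_def v_def max_def)
    qed
    moreover have "w $ e i * z $ e i \<le> a i * z $ e i" for i
      using z(1) by (intro mult_right_mono) (auto simp: a_def)
    ultimately have "0 \<le> (\<Sum>i<m. w $ e i * v $ e i - w $ e i * z $ e i)"
      by (smt (verit) d_def lessThan_iff right_diff_distrib sum_mono)
    moreover have "(\<Sum>i<m. w $ e i * x $ e i) = w \<bullet> x" for x :: "real ^ 'm"
      using sum.reindex_bij_betw[OF e, of "\<lambda>i. w $ i * x $ i"] by (simp add: inner_vec_def)
    ultimately show ?thesis by (simp add: sum_subtractf)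
  qed
  ultimately show thesis using that by blast
qed

text \<open>A point that satisfies the inequalities but lies outside the convex hull would be separated from it by a linear
functional, on which however some greedy vertex is at least as large.\<close>

lemma mem_partial_permutohedron_iff:
  fixes x :: "real ^ 'm::finite"
  assumes n: "CARD('m) \<le> n + 1"
  shows "x \<in> partial_permutohedron n \<longleftrightarrow> (\<forall>i. 0 \<le> x $ i) \<and> (\<forall>S. (\<Sum>i\<in>S. x $ i) \<le> top_sum n (card S))"
proof
  let ?Q = "{x :: real ^ 'm. (\<forall>i. 0 \<le> x $ i) \<and> (\<forall>S. (\<Sum>i\<in>S. x $ i) \<le> top_sum n (card S))}"
  have "convex ?Q"
  proof (rule convexI)
    fix x y :: "real ^ 'm" and u v :: real
    assume xy: "x \<in> ?Q" "y \<in> ?Q" and uv: "0 \<le> u" "0 \<le> v" "u + v = 1"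
    have "(\<Sum>i\<in>S. (u *\<^sub>R x + v *\<^sub>R y) $ i) \<le> top_sum n (card S)" for S
    proof -
      have "(\<Sum>i\<in>S. (u *\<^sub>R x + v *\<^sub>R y) $ i) = u * (\<Sum>i\<in>S. x $ i) + v * (\<Sum>i\<in>S. y $ i)"
        by (simp add: sum.distrib sum_distrib_left)
      also have "\<dots> \<le> u * top_sum n (card S) + v * top_sum n (card S)"
        using xy uv by (intro add_mono mult_left_mono) blast+
      also have "\<dots> = top_sum n (card S)"
        unfolding distrib_right[symmetric] uv(3) by simp
      finally show ?thesis .
    qed
    moreover have "0 \<le> (u *\<^sub>R x + v *\<^sub>R y) $ i" for i
    proof -
      have "0 \<le> x $ i" "0 \<le> y $ i" using xy by blast+
      then show ?thesis using uv by simp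
    qed
    ultimately show "u *\<^sub>R x + v *\<^sub>R y \<in> ?Q" by blast
  qed
  moreover have "partial_permutations n \<subseteq> ?Q"
  proof
    fix x :: "real ^ 'm" assume x: "x \<in> partial_permutations n"
    then have "x $ i \<in> real ` {0..n}" for i by (simp add: partial_permutations_def)
    then have "0 \<le> x $ i" for i by (metis imageE of_nat_0_le_iff)
    then show "x \<in> ?Q" using partial_permutation_sum_le[OF x n] by blast
  qed
  ultimately have "partial_permutohedron n \<subseteq> ?Q"
    unfolding partial_permutohedron_hull by (rule hull_minimal[rotated])
  then show "x \<in> partial_permutohedron n \<Longrightarrow>
      (\<forall>i. 0 \<le> x $ i) \<and> (\<forall>S. (\<Sum>i\<in>S. x $ i) \<le> top_sum n (card S))" by blast
next
  assume x: "(\<forall>i. 0 \<le> x $ i) \<and> (\<forall>S. (\<Sum>i\<in>S. x $ i) \<le> top_sum n (card S))"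
  let ?P = "partial_permutohedron n :: (real ^ 'm) set"
  show "x \<in> ?P"
  proof (rule ccontr)
    assume notin: "x \<notin> ?P"
    have convex: "convex ?P" by (simp add: partial_permutohedron_hull)
    have closed: "closed ?P"
      by (simp add: partial_permutohedron_hull compact_imp_closed finite_imp_compact_convex_hull finite_partial_permutations)
    obtain a b where ab: "a \<bullet> x < b" "\<And>y. y \<in> ?P \<Longrightarrow> b < a \<bullet> y"
      using separating_hyperplane_closed_point[OF convex closed notin] by blast
    obtain v where "v \<in> partial_permutations n" "(- a) \<bullet> x \<le> (- a) \<bullet> v"
    proof (rule greedy_partial_permutation[of x n "- a"])
      show "0 \<le> x $ i" for i using x by blast
      show "(\<Sum>i\<in>S. x $ i) \<le> top_sum n (card S)" for S using x by blast
    qed (use n in auto)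
    moreover from this(1) have "v \<in> ?P" by (simp add: partial_permutohedron_hull hull_inc)
    ultimately show False using ab(1) ab(2)[of v] by simp
  qed
qed

lemma card_dilated_lattice_points:
  assumes n: "CARD('m::finite) \<le> n + 1" and t: "t > 0"
  shows "card ((\<lambda>x. real t *\<^sub>R x) ` (partial_permutohedron n :: (real ^ 'm) set) \<inter> integer_lattice)
       = num_scores t 0 (t * n) CARD('m)"
proof -
  let ?L = "(\<lambda>x. real t *\<^sub>R x) ` (partial_permutohedron n :: (real ^ 'm) set) \<inter> integer_lattice"
  let ?Y = "score_vectors t 0 (t * n) (UNIV :: 'm set)"
  let ?h = "\<lambda>y. (\<chi> i. real (t * n) - real (y i)) :: real ^ 'm"
  have mem: "x \<in> (\<lambda>x. real t *\<^sub>R x) ` (partial_permutohedron n :: (real ^ 'm) set) \<longleftrightarrow>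
      (\<forall>i. 0 \<le> x $ i) \<and> (\<forall>S. (\<Sum>i\<in>S. x $ i) \<le> real t * top_sum n (card S))" for x :: "real ^ 'm"
  proof -
    have "x \<in> (\<lambda>x. real t *\<^sub>R x) ` (partial_permutohedron n :: (real ^ 'm) set) \<longleftrightarrow>
        (1 / real t) *\<^sub>R x \<in> partial_permutohedron n"
    proof
      assume "(1 / real t) *\<^sub>R x \<in> partial_permutohedron n"
      then show "x \<in> (\<lambda>x. real t *\<^sub>R x) ` (partial_permutohedron n)"
        using t by (intro image_eqI[of _ _ "(1 / real t) *\<^sub>R x"]) auto
    qed (use t in auto)
    also have "\<dots> \<longleftrightarrow> (\<forall>i. 0 \<le> x $ i) \<and> (\<forall>S. (\<Sum>i\<in>S. x $ i) \<le> real t * top_sum n (card S))"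
      unfolding mem_partial_permutohedron_iff[OF n] using t
      by (simp add: sum_divide_distrib[symmetric] divide_le_eq zero_le_divide_iff mult.commute)
    finally show ?thesis .
  qed
  have sum_h: "(\<Sum>i\<in>S. ?h y $ i) \<le> real t * top_sum n (card S) \<longleftrightarrow> t * (card S choose 2) \<le> sum y S" for y S
  proof -
    have "(\<Sum>i\<in>S. ?h y $ i) = real (card S) * (real t * real n) - real (sum y S)"
      by (simp add: sum_subtractf)
    moreover have "real t * top_sum n (card S) = real (card S) * (real t * real n) - real (t * (card S choose 2))"
      by (simp add: top_sum_eq algebra_simps)
    moreover have "real (t * (card S choose 2)) \<le> real (sum y S) \<longleftrightarrow> t * (card S choose 2) \<le> sum y S"
      by (rule of_nat_le_iff)
    ultimately show ?thesis by linarith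
  qed
  have "bij_betw ?h ?Y ?L"
    unfolding bij_betw_def
  proof
    show "inj_on ?h ?Y"
      by (rule inj_onI) (simp add: vec_eq_iff fun_eq_iff)
    show "?h ` ?Y = ?L"
    proof (intro subset_antisym subsetI)
      fix x assume "x \<in> ?h ` ?Y"
      then obtain y where y: "y \<in> ?Y" "x = ?h y" by blast
      have "0 \<le> ?h y $ i" for i
        using score_vectors_le[OF y(1), of i] by (simp flip: of_nat_mult)
      moreover have "(\<Sum>i\<in>S. ?h y $ i) \<le> real t * top_sum n (card S)" for S
        unfolding sum_h by (rule score_vectors_sum_ge_0[OF y(1)]) simp
      moreover have "?h y \<in> integer_lattice" by (simp add: integer_lattice_def)
      ultimately show "x \<in> ?L" unfolding y(2) using mem[of "?h y"] by blast
    next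
      fix x assume "x \<in> ?L"
      then have x: "\<And>i. 0 \<le> x $ i" "\<And>S. (\<Sum>i\<in>S. x $ i) \<le> real t * top_sum n (card S)"
        and int: "\<And>i. x $ i \<in> \<int>" using mem[of x] by (auto simp: integer_lattice_def)
      define y where "y i = nat (int (t * n) - \<lfloor>x $ i\<rfloor>)" for i
      have le: "x $ i \<le> real t * real n" for i
        using x(2)[of "{i}"] by simp
      have y: "real (y i) = real (t * n) - x $ i" for i
      proof -
        have "\<lfloor>x $ i\<rfloor> = x $ i" using int by (metis Ints_cases floor_of_int)
        moreover have "0 \<le> int (t * n) - \<lfloor>x $ i\<rfloor>"
        proof -
          have "\<lfloor>x $ i\<rfloor> \<le> \<lfloor>real (t * n)\<rfloor>" using le[of i] by (intro floor_mono) simp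
          also have "\<dots> = int (t * n)" by (rule floor_of_nat)
          finally show ?thesis by linarith
        qed
        ultimately show ?thesis by (simp add: y_def)
      qed
      have xh: "x = ?h y" by (simp add: vec_eq_iff y)
      have "y \<in> ?Y"
      proof (rule score_vectorsI)
        show "y \<in> UNIV \<rightarrow>\<^sub>E {..t * n}"
        proof (rule PiE_I)
          fix i :: 'm
          have "real (y i) \<le> real (t * n)" using y[of i] x(1)[of i] by simp
          then show "y i \<in> {..t * n}" by (simp only: of_nat_le_iff atMost_iff)
        qed simp
        fix S :: "'m set"
        show "t * (card S choose 2) + 0 \<le> sum y S"
          using x(2)[of S] sum_h[of y S] xh by simp
      qed
      then show "x \<in> ?h ` ?Y" using xh by blast
    qed
  qed
  then have "card ?L = card ?Y" by (simp add: bij_betw_same_card)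
  then show ?thesis by (simp add: card_score_vectors)
qed

section \<open>Magic positivity\<close>

lemma aff_dim_partial_permutohedron:
  assumes "n > 0"
  shows "aff_dim (partial_permutohedron n :: (real ^ 'm::finite) set) = int CARD('m)"
proof -
  let ?V = "partial_permutations n :: (real ^ 'm) set"
  have 0: "0 \<in> ?V" by (force simp: partial_permutations_def)
  have "axis i 1 \<in> ?V" for i
    using assms by (force simp: partial_permutations_def axis_def)
  then have "Basis \<subseteq> ?V" by (auto simp: Basis_vec_def)
  then have "DIM(real ^ 'm) \<le> dim ?V"
    by (metis dim_subset dim_UNIV dim_span span_Basis)
  then have "dim ?V = CARD('m)" using dim_subset_UNIV[of ?V] by simp
  then show ?thesis
    unfolding partial_permutohedron_hull aff_dim_convex_hull
    using 0 by (simp add: aff_dim_zero hull_inc)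
qed

lemma is_ehrhart_poly_partial_permutohedron:
  assumes "CARD('m::finite) \<le> n + 1"
  shows "is_ehrhart_poly (partial_permutohedron n :: (real ^ 'm) set)
    (\<Sum>i\<le>CARD('m). smult (magic_coeff CARD('m) n i) ([:0, 1:] ^ i * [:1, 1:] ^ (CARD('m) - i)))"
  unfolding is_ehrhart_poly_def
proof (intro allI impI)
  fix t :: nat assume t: "t > 0"
  show "poly (\<Sum>i\<le>CARD('m). smult (magic_coeff CARD('m) n i) ([:0, 1:] ^ i * [:1, 1:] ^ (CARD('m) - i))) (real t)
      = real (card ((\<lambda>x. real t *\<^sub>R x) ` (partial_permutohedron n :: (real ^ 'm) set) \<inter> integer_lattice))"
    unfolding card_dilated_lattice_points[OF assms t] num_scores_magic_expansion[OF assms t]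
    by (simp add: poly_sum add.commute)
qed

text \<open>Evaluating at \<open>0\<close>, \<open>- 1\<close> and \<open>1\<close> isolates the three coefficients one after the other.\<close>

lemma magic_coefficient_1_unique:
  fixes a b :: "nat \<Rightarrow> real"
  assumes "(\<Sum>i\<le>2. smult (a i) ([:0, 1:] ^ i * [:1, 1:] ^ (2 - i)))
         = (\<Sum>i\<le>2. smult (b i) ([:0, 1:] ^ i * [:1, 1:] ^ (2 - i)))" (is "?p = ?q")
  shows "a 1 = b 1"
proof -
  have set: "{..2} = {0, 1, 2 :: nat}" by auto
  have expand: "poly (\<Sum>i\<le>2. smult (c i) ([:0, 1:] ^ i * [:1, 1:] ^ (2 - i))) x
      = c 0 * (x + 1)\<^sup>2 + c 1 * (x * (x + 1)) + c 2 * x\<^sup>2" for c :: "nat \<Rightarrow> real" and x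
    by (simp add: poly_sum set algebra_simps power2_eq_square)
  have "poly ?p x = poly ?q x" for x by (simp only: assms)
  note eq = this[unfolded expand]
  have "a 0 = b 0" "a 2 = b 2" using eq[of 0] eq[of "-1"] by simp_all
  moreover have "4 * a 0 + 2 * a 1 + a 2 = 4 * b 0 + 2 * b 1 + b 2"
    using eq[of 1] by simp
  ultimately show ?thesis by simp
qed

theorem theorem1p3:
  fixes n :: nat
  assumes "n > 0" and "n \<ge> CARD('m::finite) - 1"
  shows "((CARD('m), n) \<noteq> (2, 1) \<longrightarrow>
            magic_positive (partial_permutohedron n :: (real ^ 'm) set)) \<and>
         ((CARD('m), n) = (2, 1) \<longrightarrow>
            \<not> magic_positive (partial_permutohedron n :: (real ^ 'm) set))"
proof -
  let ?P = "partial_permutohedron n :: (real ^ 'm) set" and ?m = "CARD('m)"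
  let ?p = "\<lambda>a. \<Sum>i\<le>?m. smult (a i) ([:0, 1:] ^ i * [:1, 1:] ^ (?m - i)) :: real poly"
  have m: "?m \<le> n + 1" using assms(2) by linarith
  have ehrhart: "ehrhart_poly ?P = ?p (magic_coeff ?m n)"
    by (rule ehrhart_poly_eqI) (rule is_ehrhart_poly_partial_permutohedron[OF m])
  have magic: "magic_positive ?P \<longleftrightarrow> (\<exists>a. (\<forall>i\<le>?m. a i \<ge> 0) \<and> ?p (magic_coeff ?m n) = ?p a)"
    unfolding magic_positive_def magic_positive_poly_def ehrhart
      aff_dim_partial_permutohedron[OF assms(1)] nat_int by (rule refl)
  show ?thesis
  proof (intro conjI impI)
    assume "(?m, n) \<noteq> (2, 1)"
    then have "0 \<le> magic_coeff ?m n i" for i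
      by (rule magic_coeff_nonneg[OF zero_less_card_finite assms(1) m])
    then show "magic_positive ?P" unfolding magic by (intro exI[of _ "magic_coeff ?m n"] conjI allI impI refl)
  next
    assume "(?m, n) = (2, 1)"
    then have m2: "?m = 2" and n1: "n = 1" by simp_all
    show "\<not> magic_positive ?P"
    proof
      assume "magic_positive ?P"
      then obtain a where a: "\<forall>i\<le>?m. a i \<ge> 0" "?p (magic_coeff ?m n) = ?p a"
        unfolding magic by (elim exE conjE) (rule that)
      have "magic_coeff 2 1 1 = a 1"
        by (rule magic_coefficient_1_unique) (rule a(2)[unfolded m2 n1])
      moreover have "0 \<le> a 1" using a(1) unfolding m2 by (rule allE[of _ 1]) simp
      ultimately show False using magic_coeff_2_1_neg by simp
    qed
  qed
qed

end
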